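(* Let $d\geqslant 2$ and let $\Omega\subset\mathbb{R}^d$ be a convex body whose boundary $\partial\Omega$ is smooth with finite order of contact at every point, and assume that the origin is an interior point of $\Omega$. For a unit vector $\Theta$ let $A_{\Omega,\Theta}(t)=\mathrm{Vol}_{d-1}\left(\Omega\cap\{x: x\cdot\Theta=t\}\right)$, whose support is an interval $[-a,b]$ with $a=a(\Theta)>0$, $b=b(\Theta)>0$. Then there exist positive constants $\alpha,\beta,c,C$ such that for every unit vector $\Theta$ and every $\rho>c$, \[ \int_{\alpha\rho\leqslant s\leqslant\beta\rho} \left|\widehat{\chi_{\Omega}}\left(s\Theta\right)\right|^{2}ds \geqslant \frac{C}{\rho}\left[A_{\Omega,\Theta}\left(-a+\rho^{-1}\right)^{2}+A_{\Omega,\Theta}\left(b-\rho^{-1}\right)^{2}\right]. \]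
   Context: $\chi_\Omega$ is the characteristic function of $\Omega$ and $\widehat{f}(\xi)=\int_{\mathbb{R}^d}f(x)e^{-2\pi i\xi\cdot x}dx$. A convex body is a compact convex set with nonempty interior. "Finite order of contact at every point" means that at each point of $\partial\Omega$, every tangent line has finite order of contact with $\partial\Omega$. $A_{\Omega,\Theta}$ is the parallel section function of $\Omega$ in direction $\Theta$. *)

theory Defs
  imports "HOL-Analysis.Analysis"
begin

definition convex_body :: "'a::euclidean_space set \<Rightarrow> bool" where
  "convex_body \<Omega> \<longleftrightarrow> compact \<Omega> \<and> convex \<Omega> \<and> interior \<Omega> \<noteq> {}"

text \<open>Class $C^k$ on a set, via iterated directional derivatives; used on open sets only.\<close>

primrec Ck_on ::
  "nat \<Rightarrow> ('a::real_normed_vector \<Rightarrow> 'b::real_normed_vector) \<Rightarrow> 'a set \<Rightarrow> bool" where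
  "Ck_on 0 f U \<longleftrightarrow> continuous_on U f"
| "Ck_on (Suc k) f U \<longleftrightarrow>
     (\<forall>x\<in>U. f differentiable (at x)) \<and>
     (\<forall>v. Ck_on k (\<lambda>x. frechet_derivative f (at x) v) U)"

definition smooth_on ::
  "('a::real_normed_vector \<Rightarrow> 'b::real_normed_vector) \<Rightarrow> 'a set \<Rightarrow> bool" where
  "smooth_on f U \<longleftrightarrow> (\<forall>k. Ck_on k f U)"

definition local_defining_function ::
  "'a::euclidean_space set \<Rightarrow> 'a \<Rightarrow> 'a set \<Rightarrow> ('a \<Rightarrow> real) \<Rightarrow> bool" where
  "local_defining_function S p U \<phi> \<longleftrightarrow>
     open U \<and> p \<in> U \<and> smooth_on \<phi> U \<and>
     S \<inter> U = {x \<in> U. \<phi> x = 0} \<and>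
     (\<forall>x \<in> S \<inter> U. \<exists>v. frechet_derivative \<phi> (at x) v \<noteq> 0)"

definition smooth_hypersurface :: "'a::euclidean_space set \<Rightarrow> bool" where
  "smooth_hypersurface S \<longleftrightarrow> (\<forall>p\<in>S. \<exists>U \<phi>. local_defining_function S p U \<phi>)"

text \<open>The line through \<open>p\<close> with direction \<open>v\<close> is tangent to \<open>S\<close> at \<open>p\<close>. The choice of local
  defining function is immaterial here and in the next definition: two of them differ near
  \<open>p\<close> by a nowhere vanishing smooth factor.\<close>

definition tangent_line_at :: "'a::euclidean_space set \<Rightarrow> 'a \<Rightarrow> 'a \<Rightarrow> bool" where
  "tangent_line_at S p v \<longleftrightarrow> v \<noteq> 0 \<and>
     (\<exists>U \<phi>. local_defining_function S p U \<phi> \<and> frechet_derivative \<phi> (at p) v = 0)"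

text \<open>The order of contact is the order of vanishing at \<open>t = 0\<close> of a defining function along the
  line \<open>p + t v\<close>. Tangent lines have order at least 2; a normalization that is shifted
  by one does not affect finiteness.\<close>

definition contact_order :: "'a::euclidean_space set \<Rightarrow> 'a \<Rightarrow> 'a \<Rightarrow> nat \<Rightarrow> bool" where
  "contact_order S p v k \<longleftrightarrow>
     (\<exists>U \<phi>. local_defining_function S p U \<phi> \<and>
        (\<forall>j<k. (deriv ^^ j) (\<lambda>t::real. \<phi> (p + t *\<^sub>R v)) 0 = 0) \<and>
        (deriv ^^ k) (\<lambda>t::real. \<phi> (p + t *\<^sub>R v)) 0 \<noteq> 0)"

definition finite_order_of_contact :: "'a::euclidean_space set \<Rightarrow> bool" where
  "finite_order_of_contact S \<longleftrightarrow>
     (\<forall>p\<in>S. \<forall>v. tangent_line_at S p v \<longrightarrow> (\<exists>k. contact_order S p v k))"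

definition orthonormal_basis_of :: "'a::euclidean_space set \<Rightarrow> 'a set \<Rightarrow> bool" where
  "orthonormal_basis_of W B \<longleftrightarrow>
     pairwise orthogonal B \<and> (\<forall>b\<in>B. norm b = 1) \<and> span B = W"

lemma orthonormal_basis_of_exists:
  assumes "subspace W"
  shows "\<exists>B. orthonormal_basis_of W B"
  using orthonormal_basis_subspace[OF assms] unfolding orthonormal_basis_of_def by metis

text \<open>Lebesgue measure of dimension \<open>dim W\<close> on a linear subspace \<open>W\<close>, as a measure on the ambient
  space concentrated on \<open>W\<close>. It is the analogue of the library definition of \<open>lborel\<close>, with an
  orthonormal basis of \<open>W\<close> in place of \<open>Basis\<close>, and does not depend on that basis.\<close>

definition subspace_lborel :: "'a::euclidean_space set \<Rightarrow> 'a measure" where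
  "subspace_lborel W =
     (let B = (SOME B. orthonormal_basis_of W B)
      in distr (\<Pi>\<^sub>M b\<in>B. (lborel :: real measure)) borel (\<lambda>f. \<Sum>b\<in>B. f b *\<^sub>R b))"

text \<open>The volume of dimension \<open>d - 1\<close> of the slice is computed after translating the slice
  to the linear hyperplane orthogonal to \<open>\<Theta>\<close>.\<close>

definition parallel_section :: "'a::euclidean_space set \<Rightarrow> 'a \<Rightarrow> real \<Rightarrow> real" where
  "parallel_section \<Omega> \<Theta> t =
     measure (subspace_lborel {x. x \<bullet> \<Theta> = 0})
       ((\<lambda>x. x - t *\<^sub>R \<Theta>) ` (\<Omega> \<inter> {x. x \<bullet> \<Theta> = t}))"

definition fourier_transform :: "('a::euclidean_space \<Rightarrow> complex) \<Rightarrow> 'a \<Rightarrow> complex" where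
  "fourier_transform f \<xi> =
     (LINT x|lborel. f x * exp (- 2 * of_real pi * \<i> * of_real (\<xi> \<bullet> x)))"

end

theory Submission
  imports Defs
begin

text \<open>Pair \<open>A (b - y / \<rho>)\<close> with the test function \<open>\<psi> y = exp (\<i> \<alpha> y) * \<kappa> y ^ N\<close>, where \<open>\<kappa>\<close> is the
  Fourier transform of a density on \<open>[0, \<beta>]\<close>. The frequencies of \<open>\<psi>\<close> lie in \<open>[\<alpha>, \<alpha> + N \<beta>]\<close>, so by
  Cauchy--Schwarz the pairing is controlled by the integral of the squared Fourier transform over
  this range scaled by \<open>\<rho> / (2 \<pi>)\<close>. Explicitly, \<open>\<kappa> y = \<i> * (1 - q * exp (\<i> \<beta> (y + 1))) / (y + 1 + \<i> \<delta>)\<close>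
  with \<open>q = exp (- \<delta> \<beta>)\<close>, so for small \<open>\<delta>\<close> and \<open>q\<close> the power \<open>\<kappa> y ^ N\<close> has, up to a constant phase,
  real part comparable to \<open>(1 + y) ^ - N\<close> on the whole half line. Taking \<open>\<alpha>\<close> small keeps this
  positivity for \<open>\<psi>\<close> on a long interval \<open>[0, R]\<close>.

  Convexity gives the two bounds on \<open>A\<close> that are needed: cones over a slice with apex at an extreme
  point of \<open>\<Omega>\<close> show that \<open>A (b - \<tau> / \<rho>)\<close> is at least \<open>\<tau> ^ m * A (b - 1 / \<rho>)\<close> for \<open>\<tau> \<le> 1\<close> and at
  most a constant times \<open>(1 + \<tau>) ^ m * A (b - 1 / \<rho>)\<close> in general, with \<open>m = d - 1\<close>. For \<open>N = m + 2\<close>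
  the contribution of \<open>[0, 1]\<close> beats the tail beyond \<open>R\<close>. The other end point is the same statement
  for \<open>- \<Theta>\<close>.\<close>

section \<open>Lebesgue measure in orthonormal coordinates\<close>

lemma nn_integral_lborel_translate:
  fixes f :: "'a::euclidean_space \<Rightarrow> ennreal"
  assumes [measurable]: "f \<in> borel_measurable borel"
  shows "(\<integral>\<^sup>+x. f (c + x) \<partial>lborel) = (\<integral>\<^sup>+x. f x \<partial>lborel)"
  by (subst (2) lborel_distr_plus[of c, symmetric]) (simp add: nn_integral_distr)

lemma nn_integral_lborel_reflect:
  fixes f :: "'a::euclidean_space \<Rightarrow> ennreal"
  assumes [measurable]: "f \<in> borel_measurable borel"
  shows "(\<integral>\<^sup>+x. f (c - x) \<partial>lborel) = (\<integral>\<^sup>+x. f x \<partial>lborel)"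
proof -
  have "lborel = distr lborel borel (\<lambda>x::'a. c - x)"
    using lborel_affine[of "-1" c] by (simp add: density_1)
  then have "(\<integral>\<^sup>+x. f x \<partial>lborel) = (\<integral>\<^sup>+x. f x \<partial>distr lborel borel (\<lambda>x::'a. c - x))"
    by simp
  then show ?thesis
    by (simp add: nn_integral_distr)
qed

text \<open>Uniqueness of Haar measure, by the usual double integral of \<open>f x * g (x + L z)\<close>
  with \<open>g\<close> the indicator of the unit ball.\<close>

lemma nn_integral_lborel_orthogonal:
  fixes L :: "'a::euclidean_space \<Rightarrow> 'a" and f :: "'a \<Rightarrow> ennreal"
  assumes L: "orthogonal_transformation L" and f[measurable]: "f \<in> borel_measurable borel"
  shows "(\<integral>\<^sup>+x. f (L x) \<partial>lborel) = (\<integral>\<^sup>+x. f x \<partial>lborel)"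
proof -
  define L' where "L' = inv L"
  have lin: "linear L" and L'L: "L (L' x) = x" for x
    using L orthogonal_transformation_surj[OF L]
    by (auto simp: orthogonal_transformation_linear L'_def surj_f_inv_f)
  have [measurable]: "L \<in> borel_measurable borel"
    using lin by (intro borel_measurable_continuous_onI linear_continuous_on)
      (simp add: linear_conv_bounded_linear)
  define g :: "'a \<Rightarrow> ennreal" where "g = indicator (ball 0 1)"
  have [measurable]: "g \<in> borel_measurable borel" unfolding g_def
    by (intro borel_measurable_indicator) simp
  have gL: "g (L x) = g x" for x
    using orthogonal_transformation_norm[OF L] by (simp add: g_def indicator_def)
  \<comment> \<open>Writing \<open>x = L (L' x)\<close> moves the shift inside \<open>L\<close>; as
    \<open>g\<close> is radial, the inner integral does not depend on \<open>x\<close>.\<close>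
  have 1: "(\<integral>\<^sup>+z. g (x + L z) \<partial>lborel) = (\<integral>\<^sup>+z. g z \<partial>lborel)" for x
  proof -
    have "(\<integral>\<^sup>+z. g (x + L z) \<partial>lborel) = (\<integral>\<^sup>+z. g (L (L' x + z)) \<partial>lborel)"
      using lin by (simp add: linear_add L'L)
    also have "\<dots> = (\<integral>\<^sup>+z. g z \<partial>lborel)"
      by (simp only: gL) (rule nn_integral_lborel_translate, measurable)
    finally show ?thesis .
  qed
  have 2: "(\<integral>\<^sup>+z. f (x - L z) \<partial>lborel) = (\<integral>\<^sup>+z. f (L z) \<partial>lborel)" for x
  proof -
    have "(\<integral>\<^sup>+z. f (x - L z) \<partial>lborel) = (\<integral>\<^sup>+z. f (L (L' x - z)) \<partial>lborel)"
      using lin by (simp add: linear_diff L'L)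
    also have "\<dots> = (\<integral>\<^sup>+z. f (L z) \<partial>lborel)"
      by (rule nn_integral_lborel_reflect[of "\<lambda>x. f (L x)"]) measurable
    finally show ?thesis .
  qed
  have "(\<integral>\<^sup>+x. f x \<partial>lborel) * (\<integral>\<^sup>+z. g z \<partial>lborel) = (\<integral>\<^sup>+x. (\<integral>\<^sup>+z. f x * g (x + L z) \<partial>lborel) \<partial>lborel)"
    by (simp add: nn_integral_cmult 1 nn_integral_multc)
  also have "\<dots> = (\<integral>\<^sup>+z. (\<integral>\<^sup>+x. f x * g (x + L z) \<partial>lborel) \<partial>lborel)"
    by (rule lborel_pair.Fubini') measurable
  also have "\<dots> = (\<integral>\<^sup>+z. (\<integral>\<^sup>+x. f (x - L z) * g x \<partial>lborel) \<partial>lborel)"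
  proof (rule nn_integral_cong)
    fix z
    have "(\<integral>\<^sup>+x. f (- L z + x) * g (- L z + x + L z) \<partial>lborel) = (\<integral>\<^sup>+x. f x * g (x + L z) \<partial>lborel)"
      by (rule nn_integral_lborel_translate) measurable
    then show "(\<integral>\<^sup>+x. f x * g (x + L z) \<partial>lborel) = (\<integral>\<^sup>+x. f (x - L z) * g x \<partial>lborel)"
      by simp
  qed
  also have "\<dots> = (\<integral>\<^sup>+x. (\<integral>\<^sup>+z. f (x - L z) * g x \<partial>lborel) \<partial>lborel)"
    by (rule lborel_pair.Fubini'[symmetric]) measurable
  also have "\<dots> = (\<integral>\<^sup>+z. f (L z) \<partial>lborel) * (\<integral>\<^sup>+x. g x \<partial>lborel)"
    by (simp add: nn_integral_multc 2 nn_integral_cmult)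
  finally have eq: "(\<integral>\<^sup>+x. f x \<partial>lborel) * (\<integral>\<^sup>+z. g z \<partial>lborel) = (\<integral>\<^sup>+z. f (L z) \<partial>lborel) * (\<integral>\<^sup>+x. g x \<partial>lborel)" .
  have ball: "(\<integral>\<^sup>+z. g z \<partial>lborel) = emeasure lborel (ball (0::'a) 1)"
    by (simp add: g_def)
  \<comment> \<open>Cancelling this common factor in \<open>ennreal\<close> requires it to be
    neither 0 nor infinite.\<close>
  have "emeasure lborel (ball (0::'a) 1) \<noteq> 0" "emeasure lborel (ball (0::'a) 1) \<noteq> top"
    using unit_ball_vol_pos[of "real DIM('a)", THEN less_imp_neq, symmetric]
    by (simp_all add: emeasure_ball)
  then show ?thesis
    using eq ball by (metis mult_divide_eq_ennreal)
qed

text \<open>The linear map \<open>L\<close> taking the standard basis to \<open>B\<close> along a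
  bijection \<open>\<pi>\<close> is orthogonal, so it preserves \<open>lborel\<close>. As
  \<open>lborel\<close> is the product measure in standard coordinates, it remains to relabel
  coordinates along \<open>\<pi>\<close>.\<close>

lemma nn_integral_lborel_orthonormal:
  fixes B :: "'a::euclidean_space set" and f :: "'a \<Rightarrow> ennreal"
  assumes orth: "pairwise orthogonal B" "\<And>b. b \<in> B \<Longrightarrow> norm b = 1"
    and card: "card B = DIM('a)" and f[measurable]: "f \<in> borel_measurable borel"
  shows "(\<integral>\<^sup>+x. f x \<partial>lborel) = (\<integral>\<^sup>+\<phi>. f (\<Sum>b\<in>B. \<phi> b *\<^sub>R b) \<partial>(\<Pi>\<^sub>M b\<in>B. (lborel :: real measure)))"
proof -
  have "finite B" using card by (metis DIM_positive card.infinite less_irrefl)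
  with card have "\<exists>\<pi>. bij_betw \<pi> (Basis :: 'a set) B"
    by (intro finite_same_card_bij) auto
  then obtain \<pi> :: "'a \<Rightarrow> 'a" where \<pi>: "bij_betw \<pi> Basis B"
    by blast
  define L :: "'a \<Rightarrow> 'a" where "L x = (\<Sum>b\<in>Basis. (x \<bullet> b) *\<^sub>R \<pi> b)" for x
  have \<pi>B: "\<pi> b \<in> B" if "b \<in> Basis" for b using \<pi> that by (auto simp: bij_betw_def)
  have inner: "\<pi> b \<bullet> \<pi> c = (if b = c then 1 else 0)" if "b \<in> Basis" "c \<in> Basis" for b c
  proof -
    have "\<pi> b = \<pi> c \<longleftrightarrow> b = c"
      using inj_on_eq_iff[OF bij_betw_imp_inj_on[OF \<pi>] that] .
    then show ?thesis
      using orth \<pi>B[OF that(1)] \<pi>B[OF that(2)]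
      by (auto simp: norm_eq_1 pairwise_def orthogonal_def)
  qed
  have lin: "linear L"
    by (rule linearI) (simp_all add: L_def inner_add_left algebra_simps sum.distrib scaleR_sum_right)
  have "L x \<bullet> L y = x \<bullet> y" for x y
  proof -
    have "\<pi> b \<bullet> L y = y \<bullet> b" if "b \<in> Basis" for b
    proof -
      have "\<pi> b \<bullet> L y = (\<Sum>c\<in>Basis. if b = c then y \<bullet> c else 0)"
        unfolding L_def inner_sum_right using that by (intro sum.cong) (auto simp: inner)
      then show ?thesis using that by simp
    qed
    then have "L x \<bullet> L y = (\<Sum>b\<in>Basis. (x \<bullet> b) * (y \<bullet> b))"
      unfolding L_def[of x] by (simp add: inner_sum_left)
    then show ?thesis by (simp add: euclidean_inner[of x y])
  qed
  then have L: "orthogonal_transformation L"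
    using lin by (simp add: orthogonal_transformation_def)
  have [measurable]: "L \<in> borel_measurable borel"
    unfolding L_def by measurable
  interpret product_sigma_finite "\<lambda>_::'a. lborel :: real measure" ..
  define r :: "('a \<Rightarrow> real) \<Rightarrow> 'a \<Rightarrow> real" where "r \<phi> = (\<lambda>b\<in>Basis. \<phi> (\<pi> b))" for \<phi>
  have r[measurable]: "r \<in> measurable (\<Pi>\<^sub>M b\<in>B. lborel) (\<Pi>\<^sub>M b\<in>Basis. lborel)"
    unfolding r_def by (rule measurable_restrict, rule measurable_component_singleton, rule \<pi>B)
  \<comment> \<open>Product measures are determined by boxes, and relabelling only permutes the
    sides of a box.\<close>
  have re: "(\<Pi>\<^sub>M b\<in>Basis. lborel) = distr (\<Pi>\<^sub>M b\<in>B. lborel) (\<Pi>\<^sub>M b\<in>Basis. lborel) r"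
  proof (rule PiM_eqI[symmetric])
    fix A :: "'a \<Rightarrow> real set" assume A: "\<And>i. i \<in> Basis \<Longrightarrow> A i \<in> sets lborel"
    have "r -` Pi\<^sub>E Basis A \<inter> space (\<Pi>\<^sub>M b\<in>B. lborel) = Pi\<^sub>E B (\<lambda>c. A (the_inv_into Basis \<pi> c))"
      using \<pi> unfolding r_def
      by (auto simp: space_PiM PiE_def Pi_def extensional_def bij_betw_def the_inv_into_f_f)
    moreover have "Pi\<^sub>E Basis A \<in> sets (\<Pi>\<^sub>M b\<in>Basis. lborel)"
      using A by (intro sets_PiM_I_finite) auto
    moreover have "emeasure (\<Pi>\<^sub>M b\<in>B. lborel) (Pi\<^sub>E B (\<lambda>c. A (the_inv_into Basis \<pi> c)))
       = (\<Prod>c\<in>B. emeasure lborel (A (the_inv_into Basis \<pi> c)))"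
      using \<open>finite B\<close> A \<pi> by (intro emeasure_PiM) (auto simp: bij_betw_def the_inv_into_f_f)
    moreover have "\<dots> = (\<Prod>b\<in>Basis. emeasure lborel (A b))"
      using \<pi> by (subst prod.reindex_bij_betw[OF \<pi>, symmetric]) (auto simp: bij_betw_def the_inv_into_f_f)
    ultimately show "emeasure (distr (\<Pi>\<^sub>M b\<in>B. lborel) (\<Pi>\<^sub>M b\<in>Basis. lborel) r) (Pi\<^sub>E Basis A) = (\<Prod>i\<in>Basis. emeasure lborel (A i))"
      by (simp add: emeasure_distr)
  qed simp_all
  have "(\<integral>\<^sup>+x. f x \<partial>lborel) = (\<integral>\<^sup>+x. f (L x) \<partial>lborel)"
    using nn_integral_lborel_orthogonal[OF L f] ..
  also have "\<dots> = (\<integral>\<^sup>+\<phi>. f (L (\<Sum>b\<in>Basis. \<phi> b *\<^sub>R b)) \<partial>(\<Pi>\<^sub>M b\<in>Basis. lborel))"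
    by (subst lborel_eq) (simp add: nn_integral_distr)
  also have "\<dots> = (\<integral>\<^sup>+\<phi>. f (L (\<Sum>b\<in>Basis. r \<phi> b *\<^sub>R b)) \<partial>(\<Pi>\<^sub>M b\<in>B. lborel))"
    by (subst re) (simp add: nn_integral_distr)
  also have "\<dots> = (\<integral>\<^sup>+\<phi>. f (\<Sum>b\<in>B. \<phi> b *\<^sub>R b) \<partial>(\<Pi>\<^sub>M b\<in>B. lborel))"
  proof (rule nn_integral_cong)
    fix \<phi> :: "'a \<Rightarrow> real"
    have "L (\<Sum>b\<in>Basis. r \<phi> b *\<^sub>R b) = (\<Sum>b\<in>Basis. \<phi> (\<pi> b) *\<^sub>R \<pi> b)"
      by (simp add: L_def r_def)
    also have "\<dots> = (\<Sum>b\<in>B. \<phi> b *\<^sub>R b)"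
      by (rule sum.reindex_bij_betw[OF \<pi>])
    finally show "f (L (\<Sum>b\<in>Basis. r \<phi> b *\<^sub>R b)) = f (\<Sum>b\<in>B. \<phi> b *\<^sub>R b)" by simp
  qed
  finally show ?thesis .
qed

section \<open>Lebesgue measure on a linear subspace\<close>

lemma orthonormal_basis_of_props:
  assumes "orthonormal_basis_of W B"
  shows "finite B" "B \<subseteq> W" "card B = dim W"
proof -
  have "independent B"
    using assms by (intro pairwise_orthogonal_independent) (auto simp: orthonormal_basis_of_def)
  then show "finite B" "card B = dim W"
    using assms independent_imp_finite indep_card_eq_dim_span[of B]
    by (auto simp: orthonormal_basis_of_def)
  show "B \<subseteq> W"
    using assms span_superset by (auto simp: orthonormal_basis_of_def)
qed

text \<open>\<open>SOME\<close> picks a genuine orthonormal basis because one exists; computations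
  with \<open>subspace_lborel W\<close> then take place in the coordinates of this one
  basis.\<close>

lemma subspace_lborel_basis:
  assumes "subspace W"
  obtains B where "orthonormal_basis_of W B"
    "subspace_lborel W = distr (\<Pi>\<^sub>M b\<in>B. (lborel :: real measure)) borel (\<lambda>\<phi>. \<Sum>b\<in>B. \<phi> b *\<^sub>R b)"
  using someI_ex[OF orthonormal_basis_of_exists[OF assms]] that
  by (auto simp: subspace_lborel_def Let_def)

lemma sets_subspace_lborel[simp, measurable_cong]: "sets (subspace_lborel W) = sets borel"
  by (simp add: subspace_lborel_def Let_def)

lemma space_subspace_lborel[simp]: "space (subspace_lborel W) = UNIV"
  by (simp add: subspace_lborel_def Let_def)

lemma AE_subspace_lborel:
  fixes W :: "'a::euclidean_space set"
  assumes "subspace W"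
  shows "AE x in subspace_lborel W. x \<in> W"
proof -
  obtain B where B: "orthonormal_basis_of W B"
    and eq: "subspace_lborel W = distr (\<Pi>\<^sub>M b\<in>B. (lborel :: real measure)) borel (\<lambda>\<phi>. \<Sum>b\<in>B. \<phi> b *\<^sub>R b)"
    using subspace_lborel_basis[OF assms] .
  have [measurable]: "W \<in> sets borel" using closed_subspace[OF assms] by simp
  have "(\<Sum>b\<in>B. \<phi> b *\<^sub>R b) \<in> W" for \<phi> :: "'a \<Rightarrow> real"
    using orthonormal_basis_of_props[OF B] assms
    by (intro subspace_sum) (auto intro: subspace_scale)
  moreover have "{x. x \<in> W} \<in> sets borel" by simp
  ultimately show ?thesis
    unfolding eq by (subst AE_distr_iff) auto
qed

text \<open>A coordinate in an orthonormal basis is at most the norm, so a ball of radius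
  \<open>R\<close> pulls back into the cube with sides \<open>{-R..R}\<close>.\<close>

lemma emeasure_subspace_lborel_bounded:
  fixes W :: "'a::euclidean_space set"
  assumes "subspace W" "bounded E"
  shows "emeasure (subspace_lborel W) E < \<infinity>"
proof -
  obtain B where B: "orthonormal_basis_of W B"
    and eq: "subspace_lborel W = distr (\<Pi>\<^sub>M b\<in>B. (lborel :: real measure)) borel (\<lambda>\<phi>. \<Sum>b\<in>B. \<phi> b *\<^sub>R b)"
    using subspace_lborel_basis[OF assms(1)] .
  note p = orthonormal_basis_of_props[OF B]
  interpret product_sigma_finite "\<lambda>_::'a. lborel :: real measure" ..
  obtain R where R: "\<And>x. x \<in> E \<Longrightarrow> norm x \<le> R" using assms(2) bounded_iff by blast
  have coord: "(\<Sum>b\<in>B. \<phi> b *\<^sub>R b) \<bullet> c = \<phi> c" if "c \<in> B" for \<phi> :: "'a \<Rightarrow> real" and c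
  proof -
    have "(\<Sum>b\<in>B. \<phi> b *\<^sub>R b) \<bullet> c = (\<Sum>b\<in>B. if b = c then \<phi> c else 0)"
      unfolding inner_sum_left using B that
      by (intro sum.cong) (auto simp: orthonormal_basis_of_def pairwise_def orthogonal_def norm_eq_1)
    then show ?thesis using that p by simp
  qed
  have "emeasure (subspace_lborel W) E \<le> emeasure (subspace_lborel W) (cball 0 R)"
    using R by (intro emeasure_mono) auto
  also have "\<dots> = emeasure (\<Pi>\<^sub>M b\<in>B. lborel) ((\<lambda>\<phi>. \<Sum>b\<in>B. \<phi> b *\<^sub>R b) -` cball 0 R \<inter> space (\<Pi>\<^sub>M b\<in>B. (lborel :: real measure)))"
    unfolding eq by (rule emeasure_distr) auto
  also have "\<dots> \<le> emeasure (\<Pi>\<^sub>M b\<in>B. lborel) (Pi\<^sub>E B (\<lambda>_. {-R..R}))"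
  proof (rule emeasure_mono)
    show "(\<lambda>\<phi>. \<Sum>b\<in>B. \<phi> b *\<^sub>R b) -` cball 0 R \<inter> space (\<Pi>\<^sub>M b\<in>B. (lborel :: real measure)) \<subseteq> Pi\<^sub>E B (\<lambda>_. {-R..R})"
    proof
      fix \<phi> :: "'a \<Rightarrow> real"
      assume \<phi>: "\<phi> \<in> (\<lambda>\<phi>. \<Sum>b\<in>B. \<phi> b *\<^sub>R b) -` cball 0 R \<inter> space (\<Pi>\<^sub>M b\<in>B. (lborel :: real measure))"
      then have "norm (\<Sum>b\<in>B. \<phi> b *\<^sub>R b) \<le> R" by simp
      then have "\<bar>\<phi> c\<bar> \<le> R" if "c \<in> B" for c
        using Cauchy_Schwarz_ineq2[of "\<Sum>b\<in>B. \<phi> b *\<^sub>R b" c] coord[OF that, of \<phi>] B that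
        by (auto simp: orthonormal_basis_of_def)
      then show "\<phi> \<in> Pi\<^sub>E B (\<lambda>_. {-R..R})"
        using \<phi> by (simp add: space_PiM PiE_def Pi_def abs_le_iff) (metis minus_le_iff)
    qed
    show "Pi\<^sub>E B (\<lambda>_. {-R..R}) \<in> sets (\<Pi>\<^sub>M b\<in>B. (lborel :: real measure))"
      using p by (intro sets_PiM_I_finite) auto
  qed
  also have "\<dots> = (\<Prod>b\<in>B. emeasure lborel {-R..R})"
    using p by (intro emeasure_PiM) auto
  also have "\<dots> < \<infinity>"
    by (simp add: emeasure_lborel_Icc_eq ennreal_power)
  finally show ?thesis .
qed

text \<open>In coordinates, translation by \<open>w\<close> and dilation by \<open>c\<close> act on
  each of the \<open>dim W\<close> factors as a real affine map with Jacobian \<open>c\<close>. This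
  is the volume scaling behind the cone estimate.\<close>

lemma emeasure_subspace_lborel_affine:
  fixes W :: "'a::euclidean_space set"
  assumes W: "subspace W" and w: "w \<in> W" and c: "c > 0" and E[measurable]: "E \<in> sets borel"
  shows "emeasure (subspace_lborel W) E = ennreal (c ^ dim W) * emeasure (subspace_lborel W) {x. w + c *\<^sub>R x \<in> E}"
proof -
  obtain B where B: "orthonormal_basis_of W B"
    and eq: "subspace_lborel W = distr (\<Pi>\<^sub>M b\<in>B. (lborel :: real measure)) borel (\<lambda>\<phi>. \<Sum>b\<in>B. \<phi> b *\<^sub>R b)"
    using subspace_lborel_basis[OF W] .
  note p = orthonormal_basis_of_props[OF B]
  have "w \<in> span B" using w B by (simp add: orthonormal_basis_of_def)
  then obtain k where k: "w = (\<Sum>b\<in>B. k b *\<^sub>R b)"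
    using p by (auto simp: span_finite)
  define P where "P = (\<Pi>\<^sub>M b\<in>B. (lborel :: real measure))"
  define S :: "('a \<Rightarrow> real) \<Rightarrow> 'a" where "S \<phi> = (\<Sum>b\<in>B. \<phi> b *\<^sub>R b)" for \<phi>
  define q where "q \<phi> = (\<lambda>b\<in>B. k b + c * \<phi> b)" for \<phi>
  have [measurable]: "S \<in> borel_measurable P" "q \<in> measurable P P"
    unfolding P_def S_def q_def by measurable
  have Sq: "S (q \<phi>) = w + c *\<^sub>R S \<phi>" for \<phi>
    by (simp add: S_def q_def k scaleR_sum_right sum.distrib algebra_simps)
  interpret product_sigma_finite "\<lambda>_::'a. lborel :: real measure" ..
  have P: "P = density (distr P P q) (\<lambda>_. ennreal (c ^ card B))"
    unfolding P_def
  proof (rule PiM_eqI[symmetric], goal_cases)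
    case (3 A)
    have pre: "q -` Pi\<^sub>E B A \<inter> space P = Pi\<^sub>E B (\<lambda>b. (\<lambda>x. k b + c * x) -` A b)"
      by (auto simp: q_def P_def space_PiM PiE_def Pi_def extensional_def)
    have s: "(\<lambda>x. k b + c * x) -` A b \<in> sets lborel" if "b \<in> B" for b
      using measurable_sets[of "\<lambda>x. k b + c * x" borel borel "A b"] 3 that by simp
    have PA: "Pi\<^sub>E B A \<in> sets P" unfolding P_def using 3 p by (intro sets_PiM_I_finite) auto
    have one: "emeasure lborel (A b) = ennreal c * emeasure lborel ((\<lambda>x. k b + c * x) -` A b)" if "b \<in> B" for b
    proof -
      have "emeasure lborel (A b) = emeasure (density (distr lborel borel (\<lambda>x. k b + c * x)) (\<lambda>_. ennreal \<bar>c\<bar>)) (A b)"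
        using lborel_real_affine[of c "k b"] c by simp
      also have "\<dots> = ennreal c * emeasure lborel ((\<lambda>x. k b + c * x) -` A b)"
        using 3[OF that] c by (simp add: emeasure_density nn_integral_cmult emeasure_distr)
      finally show ?thesis .
    qed
    have "emeasure (density (distr P P q) (\<lambda>_. ennreal (c ^ card B))) (Pi\<^sub>E B A)
        = ennreal (c ^ card B) * emeasure P (Pi\<^sub>E B (\<lambda>b. (\<lambda>x. k b + c * x) -` A b))"
      using PA by (simp add: emeasure_density nn_integral_cmult emeasure_distr pre)
    also have "emeasure P (Pi\<^sub>E B (\<lambda>b. (\<lambda>x. k b + c * x) -` A b)) = (\<Prod>b\<in>B. emeasure lborel ((\<lambda>x. k b + c * x) -` A b))"
      unfolding P_def using s p by (intro emeasure_PiM) auto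
    also have "ennreal (c ^ card B) * \<dots> = (\<Prod>b\<in>B. emeasure lborel (A b))"
      using c by (simp add: one prod.distrib ennreal_power)
    finally show ?case by (simp add: P_def)
  qed (use p in simp_all)
  have "emeasure (subspace_lborel W) E = emeasure P (S -` E \<inter> space P)"
    unfolding eq P_def[symmetric] S_def[abs_def, symmetric] by (rule emeasure_distr) auto
  also have "\<dots> = ennreal (c ^ card B) * emeasure P (q -` (S -` E \<inter> space P) \<inter> space P)"
    by (subst P) (simp add: emeasure_density nn_integral_cmult emeasure_distr)
  also have "q -` (S -` E \<inter> space P) \<inter> space P = S -` {x. w + c *\<^sub>R x \<in> E} \<inter> space P"
    using measurable_space[of q P P] by (auto simp: Sq)
  also have "emeasure P \<dots> = emeasure (subspace_lborel W) {x. w + c *\<^sub>R x \<in> E}"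
    unfolding eq P_def[symmetric] S_def[abs_def, symmetric]
    by (rule emeasure_distr[symmetric]) auto
  finally show ?thesis by (simp add: p)
qed

text \<open>Adjoining \<open>\<Theta>\<close> to an orthonormal basis of its orthogonal complement
  gives an orthonormal basis of the whole space; splitting off the coordinate of
  \<open>\<Theta>\<close> is then Tonelli for the product measure.\<close>

lemma nn_integral_lborel_slice:
  fixes \<Theta> :: "'a::euclidean_space" and f :: "'a \<Rightarrow> ennreal"
  assumes \<Theta>: "norm \<Theta> = 1" and f[measurable]: "f \<in> borel_measurable borel"
  shows "(\<integral>\<^sup>+x. f x \<partial>lborel) = (\<integral>\<^sup>+t. (\<integral>\<^sup>+w. f (t *\<^sub>R \<Theta> + w) \<partial>subspace_lborel {x. x \<bullet> \<Theta> = 0}) \<partial>lborel)"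
    and "(\<lambda>t. \<integral>\<^sup>+w. f (t *\<^sub>R \<Theta> + w) \<partial>subspace_lborel {x. x \<bullet> \<Theta> = 0}) \<in> borel_measurable borel"
proof -
  define W where "W = {x. x \<bullet> \<Theta> = 0}"
  have W: "subspace W" unfolding W_def by (subst inner_commute) (rule subspace_hyperplane)
  obtain B where B: "orthonormal_basis_of W B"
    and eq: "subspace_lborel W = distr (\<Pi>\<^sub>M b\<in>B. (lborel :: real measure)) borel (\<lambda>\<phi>. \<Sum>b\<in>B. \<phi> b *\<^sub>R b)"
    using subspace_lborel_basis[OF W] .
  note p = orthonormal_basis_of_props[OF B]
  have "\<Theta> \<noteq> 0" using \<Theta> by auto
  have nin: "\<Theta> \<notin> B" using p(2) \<Theta> by (auto simp: W_def norm_eq_1)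
  have "dim W = DIM('a) - 1"
    using dim_hyperplane[OF \<open>\<Theta> \<noteq> 0\<close>] by (simp add: W_def inner_commute)
  then have card: "card (insert \<Theta> B) = DIM('a)"
    using p nin DIM_positive[where 'a='a] by simp
  have orth: "pairwise orthogonal (insert \<Theta> B)" "\<And>b. b \<in> insert \<Theta> B \<Longrightarrow> norm b = 1"
    using B p(2) \<Theta> by (auto simp: pairwise_insert orthogonal_def W_def orthonormal_basis_of_def inner_commute)
  interpret product_sigma_finite "\<lambda>_::'a. lborel :: real measure" ..
  interpret B: finite_product_sigma_finite "\<lambda>_::'a. lborel :: real measure" B
    by standard (rule p)
  have m: "(\<lambda>(t, \<phi>). f (t *\<^sub>R \<Theta> + (\<Sum>b\<in>B. \<phi> b *\<^sub>R b))) \<in> borel_measurable (borel \<Otimes>\<^sub>M (\<Pi>\<^sub>M b\<in>B. (lborel :: real measure)))"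
    by measurable
  have inner: "(\<integral>\<^sup>+w. f (t *\<^sub>R \<Theta> + w) \<partial>subspace_lborel W)
      = (\<integral>\<^sup>+\<phi>. f (t *\<^sub>R \<Theta> + (\<Sum>b\<in>B. \<phi> b *\<^sub>R b)) \<partial>(\<Pi>\<^sub>M b\<in>B. (lborel :: real measure)))" for t
    unfolding eq by (simp add: nn_integral_distr)
  show "(\<lambda>t. \<integral>\<^sup>+w. f (t *\<^sub>R \<Theta> + w) \<partial>subspace_lborel {x. x \<bullet> \<Theta> = 0}) \<in> borel_measurable borel"
    unfolding W_def[symmetric] inner using B.borel_measurable_nn_integral[OF m] by simp
  have "(\<integral>\<^sup>+x. f x \<partial>lborel) = (\<integral>\<^sup>+\<phi>. f (\<Sum>b\<in>insert \<Theta> B. \<phi> b *\<^sub>R b) \<partial>(\<Pi>\<^sub>M b\<in>insert \<Theta> B. (lborel :: real measure)))"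
    by (rule nn_integral_lborel_orthonormal[OF orth card f])
  also have "\<dots> = (\<integral>\<^sup>+t. (\<integral>\<^sup>+\<phi>. f (\<Sum>b\<in>insert \<Theta> B. (\<phi>(\<Theta> := t)) b *\<^sub>R b) \<partial>(\<Pi>\<^sub>M b\<in>B. (lborel :: real measure))) \<partial>lborel)"
    by (rule product_nn_integral_insert_rev[OF p(1) nin]) measurable
  also have "\<dots> = (\<integral>\<^sup>+t. (\<integral>\<^sup>+\<phi>. f (t *\<^sub>R \<Theta> + (\<Sum>b\<in>B. \<phi> b *\<^sub>R b)) \<partial>(\<Pi>\<^sub>M b\<in>B. (lborel :: real measure))) \<partial>lborel)"
  proof (intro nn_integral_cong)
    fix t and \<phi> :: "'a \<Rightarrow> real"
    have "(\<Sum>b\<in>B. (\<phi>(\<Theta> := t)) b *\<^sub>R b) = (\<Sum>b\<in>B. \<phi> b *\<^sub>R b)"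
      using nin by (intro sum.cong) auto
    then show "f (\<Sum>b\<in>insert \<Theta> B. (\<phi>(\<Theta> := t)) b *\<^sub>R b) = f (t *\<^sub>R \<Theta> + (\<Sum>b\<in>B. \<phi> b *\<^sub>R b))"
      using nin p by simp
  qed
  finally show "(\<integral>\<^sup>+x. f x \<partial>lborel) = (\<integral>\<^sup>+t. (\<integral>\<^sup>+w. f (t *\<^sub>R \<Theta> + w) \<partial>subspace_lborel {x. x \<bullet> \<Theta> = 0}) \<partial>lborel)"
    unfolding W_def[symmetric] inner .
qed

section \<open>Parallel sections of convex bodies\<close>

lemma subspace_orthogonal_complement: "subspace {x. x \<bullet> (\<Theta>::'a::euclidean_space) = 0}"
  using subspace_hyperplane[of \<Theta>] by (simp add: inner_commute)

text \<open>The set on the left is not cut down to the hyperplane, which is harmless since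
  \<open>subspace_lborel\<close> is concentrated there. Boundedness excludes infinite measure, which
  \<open>measure\<close> would turn into 0.\<close>

lemma emeasure_parallel_section:
  fixes \<Omega> :: "'a::euclidean_space set"
  assumes "compact \<Omega>" and \<Theta>: "norm \<Theta> = 1"
  shows "emeasure (subspace_lborel {x. x \<bullet> \<Theta> = 0}) {w. t *\<^sub>R \<Theta> + w \<in> \<Omega>} = ennreal (parallel_section \<Omega> \<Theta> t)"
proof -
  define W where "W = {x. x \<bullet> \<Theta> = 0}"
  have W: "subspace W" unfolding W_def by (rule subspace_orthogonal_complement)
  have eq: "(\<lambda>x. x - t *\<^sub>R \<Theta>) ` (\<Omega> \<inter> {x. x \<bullet> \<Theta> = t}) = {w \<in> W. t *\<^sub>R \<Theta> + w \<in> \<Omega>}"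
  proof (intro equalityI subsetI, goal_cases)
    case (1 x)
    then show ?case using \<Theta> by (auto simp: W_def inner_diff_left norm_eq_1)
  next
    case (2 w)
    then show ?case using \<Theta>
      by (intro image_eqI[of _ _ "t *\<^sub>R \<Theta> + w"]) (auto simp: W_def inner_add_left norm_eq_1)
  qed
  have slice: "{w. t *\<^sub>R \<Theta> + w \<in> \<Omega>} = (\<lambda>x. - (t *\<^sub>R \<Theta>) + x) ` \<Omega>"
    by (auto simp: image_iff algebra_simps intro!: bexI[of _ "t *\<^sub>R \<Theta> + x" for x])
  have comp: "compact {w. t *\<^sub>R \<Theta> + w \<in> \<Omega>}"
    unfolding slice using assms(1) by (rule compact_translation)
  then have [measurable]: "{w. t *\<^sub>R \<Theta> + w \<in> \<Omega>} \<in> sets borel"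
    by (intro borel_compact)
  have [measurable]: "W \<in> sets borel" using closed_subspace[OF W] by simp
  have inter: "{w \<in> W. t *\<^sub>R \<Theta> + w \<in> \<Omega>} = W \<inter> {w. t *\<^sub>R \<Theta> + w \<in> \<Omega>}" by auto
  have "emeasure (subspace_lborel W) {w. t *\<^sub>R \<Theta> + w \<in> \<Omega>} = emeasure (subspace_lborel W) {w \<in> W. t *\<^sub>R \<Theta> + w \<in> \<Omega>}"
    unfolding inter by (rule emeasure_eq_AE) (use AE_subspace_lborel[OF W] in auto)
  also have "\<dots> = ennreal (parallel_section \<Omega> \<Theta> t)"
  proof -
    have "bounded {w \<in> W. t *\<^sub>R \<Theta> + w \<in> \<Omega>}"
      by (rule bounded_subset[OF compact_imp_bounded[OF comp]]) auto
    then have "emeasure (subspace_lborel W) {w \<in> W. t *\<^sub>R \<Theta> + w \<in> \<Omega>} \<noteq> top"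
      using emeasure_subspace_lborel_bounded[OF W] by (metis infinity_ennreal_def less_irrefl)
    then show ?thesis
      unfolding parallel_section_def eq W_def[symmetric] by (rule emeasure_eq_ennreal_measure)
  qed
  finally show ?thesis by (simp add: W_def)
qed

lemma parallel_section_nonneg: "0 \<le> parallel_section \<Omega> \<Theta> t"
  by (simp add: parallel_section_def)

lemma parallel_section_uminus: "parallel_section \<Omega> (- \<Theta>) t = parallel_section \<Omega> \<Theta> (- t)"
proof -
  have "{x. - (x \<bullet> \<Theta>) = t} = {x. x \<bullet> \<Theta> = - t}" by auto
  then show ?thesis by (simp add: parallel_section_def)
qed

text \<open>By convexity the homothety with centre \<open>p\<close> and ratio
  \<open>\<theta>\<close> maps \<open>\<Omega>\<close> into itself. It carries the slice at height
  \<open>t\<close> into the slice at the height on the right and scales its volume by the power of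
  \<open>\<theta>\<close> on the left.\<close>

lemma parallel_section_cone:
  fixes \<Omega> :: "'a::euclidean_space set"
  assumes \<Omega>: "compact \<Omega>" "convex \<Omega>" and \<Theta>: "norm \<Theta> = 1" and p: "p \<in> \<Omega>" and \<theta>: "0 < \<theta>" "\<theta> \<le> 1"
  shows "\<theta> ^ (DIM('a) - 1) * parallel_section \<Omega> \<Theta> t
    \<le> parallel_section \<Omega> \<Theta> ((1 - \<theta>) * (p \<bullet> \<Theta>) + \<theta> * t)"
proof -
  define W where "W = {x. x \<bullet> \<Theta> = 0}"
  have W: "subspace W" unfolding W_def by (rule subspace_orthogonal_complement)
  have "\<Theta> \<noteq> 0" using \<Theta> by auto
  then have dim: "dim W = DIM('a) - 1"
    using dim_hyperplane[of \<Theta>] by (simp add: W_def inner_commute)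
  define s where "s = (1 - \<theta>) * (p \<bullet> \<Theta>) + \<theta> * t"
  \<comment> \<open>The part of the translation by \<open>(1 - \<theta>) *\<^sub>R p\<close>
    orthogonal to \<open>\<Theta>\<close>; the part along \<open>\<Theta>\<close> goes into the
    height \<open>s\<close>.\<close>
  define w0 where "w0 = (1 - \<theta>) *\<^sub>R (p - (p \<bullet> \<Theta>) *\<^sub>R \<Theta>)"
  have w0: "w0 \<in> W" using \<Theta> by (simp add: w0_def W_def inner_diff_left norm_eq_1)
  have meas: "{w. r *\<^sub>R \<Theta> + w \<in> \<Omega>} \<in> sets borel" for r
  proof -
    have "closed \<Omega>" using \<Omega>(1) compact_imp_closed by blast
    then show ?thesis
      using measurable_sets[of "\<lambda>w. r *\<^sub>R \<Theta> + w" borel borel \<Omega>] by (simp add: vimage_def)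
  qed
  have "ennreal (\<theta> ^ dim W) * emeasure (subspace_lborel W) {w. t *\<^sub>R \<Theta> + w \<in> \<Omega>}
    \<le> ennreal (\<theta> ^ dim W) * emeasure (subspace_lborel W) {w. w0 + \<theta> *\<^sub>R w \<in> {w. s *\<^sub>R \<Theta> + w \<in> \<Omega>}}"
  proof (intro mult_left_mono emeasure_mono subsetI, goal_cases)
    case (1 w)
    have "(1 - \<theta>) *\<^sub>R p + \<theta> *\<^sub>R (t *\<^sub>R \<Theta> + w) \<in> \<Omega>"
      using convexD_alt[OF \<Omega>(2) p, of "t *\<^sub>R \<Theta> + w" \<theta>] 1 \<theta> by simp
    moreover have "(1 - \<theta>) *\<^sub>R p + \<theta> *\<^sub>R (t *\<^sub>R \<Theta> + w) = s *\<^sub>R \<Theta> + (w0 + \<theta> *\<^sub>R w)"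
      by (simp add: s_def w0_def algebra_simps)
    ultimately show ?case by simp
  next
    case 2
    have "(\<lambda>w. w0 + \<theta> *\<^sub>R w) -` {w. s *\<^sub>R \<Theta> + w \<in> \<Omega>} \<in> sets borel"
      using measurable_sets[OF _ meas[of s], of "\<lambda>w. w0 + \<theta> *\<^sub>R w" borel] by simp
    then show ?case by (simp add: vimage_def)
  qed simp
  also have "\<dots> = emeasure (subspace_lborel W) {w. s *\<^sub>R \<Theta> + w \<in> \<Omega>}"
    by (rule emeasure_subspace_lborel_affine[OF W w0 \<theta>(1) meas, symmetric])
  finally have "ennreal (\<theta> ^ (DIM('a) - 1) * parallel_section \<Omega> \<Theta> t) \<le> ennreal (parallel_section \<Omega> \<Theta> s)"
    unfolding W_def emeasure_parallel_section[OF \<Omega>(1) \<Theta>]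
    using \<theta> dim by (simp add: ennreal_mult parallel_section_nonneg W_def)
  then show ?thesis
    using parallel_section_nonneg[of \<Omega> \<Theta> s] by (simp add: ennreal_le_iff s_def)
qed

text \<open>Cavalieri's principle. It converts integrals over \<open>\<Omega>\<close> of functions
  of \<open>x \<bullet> \<Theta>\<close>, the form in which the Fourier transform appears, into
  integrals against the section function, the form of the edge estimate.\<close>

lemma distr_inner_eq_parallel_section:
  fixes \<Omega> :: "'a::euclidean_space set"
  assumes \<Omega>: "compact \<Omega>" and \<Theta>: "norm \<Theta> = 1"
  shows borel_measurable_parallel_section: "parallel_section \<Omega> \<Theta> \<in> borel_measurable borel"
    and "distr (density lborel (indicator \<Omega>)) borel (\<lambda>x. x \<bullet> \<Theta>) = density lborel (\<lambda>t. ennreal (parallel_section \<Omega> \<Theta> t))"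
proof -
  define W where "W = {x. x \<bullet> \<Theta> = 0}"
  have W: "subspace W" unfolding W_def by (rule subspace_orthogonal_complement)
  have [measurable]: "\<Omega> \<in> sets borel" using \<Omega> by (rule borel_compact)
  have inner: "(\<integral>\<^sup>+w. indicator \<Omega> (t *\<^sub>R \<Theta> + w) * indicator A ((t *\<^sub>R \<Theta> + w) \<bullet> \<Theta>) \<partial>subspace_lborel W)
     = ennreal (parallel_section \<Omega> \<Theta> t) * indicator A t" if [measurable]: "A \<in> sets borel" for A t
  proof -
    have "{w. t *\<^sub>R \<Theta> + w \<in> \<Omega>} = (\<lambda>w. t *\<^sub>R \<Theta> + w) -` \<Omega>" by auto
    then have [measurable]: "{w. t *\<^sub>R \<Theta> + w \<in> \<Omega>} \<in> sets borel"
      using measurable_sets[of "\<lambda>w. t *\<^sub>R \<Theta> + w" borel borel \<Omega>] by simp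
    have "(\<integral>\<^sup>+w. indicator \<Omega> (t *\<^sub>R \<Theta> + w) * indicator A ((t *\<^sub>R \<Theta> + w) \<bullet> \<Theta>) \<partial>subspace_lborel W)
       = (\<integral>\<^sup>+w. indicator {w. t *\<^sub>R \<Theta> + w \<in> \<Omega>} w * indicator A t \<partial>subspace_lborel W)"
      using AE_subspace_lborel[OF W]
    proof (intro nn_integral_cong_AE, eventually_elim)
      case (elim w)
      then have "(t *\<^sub>R \<Theta> + w) \<bullet> \<Theta> = t"
        using \<Theta> by (simp add: W_def inner_add_left norm_eq_1)
      then show ?case by (simp add: indicator_def)
    qed
    also have "\<dots> = emeasure (subspace_lborel W) {w. t *\<^sub>R \<Theta> + w \<in> \<Omega>} * indicator A t"
      by (simp add: nn_integral_multc)
    finally show ?thesis unfolding W_def emeasure_parallel_section[OF \<Omega> \<Theta>] .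
  qed
  \<comment> \<open>With \<open>A = UNIV\<close> the section function is itself a slice integral,
    and those are measurable.\<close>
  have "(\<lambda>t. ennreal (parallel_section \<Omega> \<Theta> t) * indicator UNIV t) \<in> borel_measurable borel"
    using nn_integral_lborel_slice(2)[OF \<Theta>, of "\<lambda>x. indicator \<Omega> x * indicator UNIV (x \<bullet> \<Theta>)"] inner[of UNIV]
    by (simp add: W_def)
  then have "(\<lambda>t. enn2real (ennreal (parallel_section \<Omega> \<Theta> t))) \<in> borel_measurable borel"
    by simp
  then show [measurable]: "parallel_section \<Omega> \<Theta> \<in> borel_measurable borel"
    by (simp add: parallel_section_nonneg)
  show "distr (density lborel (indicator \<Omega>)) borel (\<lambda>x. x \<bullet> \<Theta>) = density lborel (\<lambda>t. ennreal (parallel_section \<Omega> \<Theta> t))"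
  proof (rule measure_eqI)
    fix A assume "A \<in> sets (distr (density lborel (indicator \<Omega>)) borel (\<lambda>x. x \<bullet> \<Theta>))"
    then have [measurable]: "A \<in> sets borel" by simp
    have "emeasure (distr (density lborel (indicator \<Omega>)) borel (\<lambda>x. x \<bullet> \<Theta>)) A
      = (\<integral>\<^sup>+x. indicator A x \<partial>distr (density lborel (indicator \<Omega>)) borel (\<lambda>x. x \<bullet> \<Theta>))"
      by simp
    also have "\<dots> = (\<integral>\<^sup>+x. indicator \<Omega> x * indicator A (x \<bullet> \<Theta>) \<partial>lborel)"
      by (simp add: nn_integral_distr nn_integral_density del: nn_integral_indicator)
    also have "\<dots> = (\<integral>\<^sup>+t. ennreal (parallel_section \<Omega> \<Theta> t) * indicator A t \<partial>lborel)"
      using nn_integral_lborel_slice(1)[OF \<Theta>, of "\<lambda>x. indicator \<Omega> x * indicator A (x \<bullet> \<Theta>)"] inner[of A]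
      by (simp add: W_def)
    also have "\<dots> = emeasure (density lborel (\<lambda>t. ennreal (parallel_section \<Omega> \<Theta> t))) A"
      by (simp add: emeasure_density)
    finally show "emeasure (distr (density lborel (indicator \<Omega>)) borel (\<lambda>x. x \<bullet> \<Theta>)) A
      = emeasure (density lborel (\<lambda>t. ennreal (parallel_section \<Omega> \<Theta> t))) A" .
  qed simp
qed

section \<open>Oscillatory integrals\<close>

text \<open>Cauchy--Schwarz against the constant 1, read off from the nonnegative integral of
  \<open>(f x - c)\<^sup>2\<close> with \<open>c\<close> the mean of \<open>f\<close>.\<close>

lemma (in finite_measure) square_integral_le:
  fixes f :: "'a \<Rightarrow> real"
  assumes f: "integrable M f" "integrable M (\<lambda>x. (f x)\<^sup>2)"
  shows "(LINT x|M. f x)\<^sup>2 \<le> measure M (space M) * (LINT x|M. (f x)\<^sup>2)"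
proof (cases "measure M (space M) = 0")
  case True
  then have "emeasure M (space M) = 0" by (simp add: emeasure_eq_measure)
  then have "AE x in M. f x = 0" by (intro AE_I[of _ _ "space M"]) auto
  then have "(LINT x|M. f x) = 0" by (rule integral_eq_zero_AE)
  with True show ?thesis by simp
next
  case False
  define \<mu> where "\<mu> = measure M (space M)"
  have \<mu>: "\<mu> > 0" using False by (simp add: \<mu>_def zero_less_measure_iff)
  define c where "c = (LINT x|M. f x) / \<mu>"
  have "0 \<le> (LINT x|M. (f x - c)\<^sup>2)" by simp
  also have "\<dots> = (LINT x|M. (f x)\<^sup>2 - (2 * c * f x - c\<^sup>2))"
    by (intro Bochner_Integration.integral_cong) (simp_all add: power2_diff)
  also have "\<dots> = (LINT x|M. (f x)\<^sup>2) - (2 * c * (LINT x|M. f x) - c\<^sup>2 * \<mu>)"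
    using f by (simp add: \<mu>_def)
  also have "\<dots> = (LINT x|M. (f x)\<^sup>2) - (LINT x|M. f x)\<^sup>2 / \<mu>"
    using \<mu> by (simp add: c_def power2_eq_square field_simps)
  finally show ?thesis
    using \<mu> by (simp add: \<mu>_def[symmetric] field_simps)
qed

lemma finite_measure_restrict_lborel_Icc: "finite_measure (restrict_space lborel {a..b::real})"
  by (rule finite_measureI) (simp add: space_restrict_space emeasure_restrict_space emeasure_lborel_Icc_eq)

lemma set_integral_shift:
  fixes f :: "real \<Rightarrow> 'a::{banach, second_countable_topology}"
  shows "(LINT u:{0..r}|lborel. f (s + u)) = (LINT v:{s..s + r}|lborel. f v)"
  unfolding set_lebesgue_integral_def
  by (subst lborel_integral_real_affine[of 1 "\<lambda>v. indicator {s..s + r} v *\<^sub>R f v" s])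
    (auto intro!: Bochner_Integration.integral_cong simp: indicator_def)

text \<open>Closed form of the integral of \<open>exp (u * (- \<delta> + \<i> * (y + 1)))\<close>
  over \<open>u\<close> in \<open>[0, \<beta>]\<close>, hence a superposition of frequencies up to
  \<open>\<beta>\<close>. The damping \<open>\<delta>\<close> keeps the denominator away from 0 on
  the whole line and makes the exponential small at \<open>u = \<beta>\<close>; the shift by 1 makes
  the decay comparable to \<open>1 / (1 + y)\<close> down to \<open>y = 0\<close>.\<close>

definition \<kappa> :: "real \<Rightarrow> real \<Rightarrow> real \<Rightarrow> complex" where
  "\<kappa> \<delta> \<beta> y = (exp (\<beta> *\<^sub>R Complex (- \<delta>) (y + 1)) - 1) / Complex (- \<delta>) (y + 1)"

lemma Complex_neg_nonzero: "\<delta> > 0 \<Longrightarrow> Complex (- \<delta>) y \<noteq> 0"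
  by (simp add: complex_eq_iff)

lemma measurable_Complex[measurable (raw)]:
  assumes "f \<in> borel_measurable M" "g \<in> borel_measurable M"
  shows "(\<lambda>x. Complex (f x) (g x)) \<in> borel_measurable M"
  using assms unfolding Complex_eq by measurable

lemma measurable_\<kappa>[measurable]: "\<kappa> \<delta> \<beta> \<in> borel_measurable borel"
  unfolding \<kappa>_def[abs_def] by measurable

lemma \<kappa>_integral:
  assumes "\<delta> > 0" "\<beta> \<ge> 0"
  shows "(LINT u:{0..\<beta>}|lborel. exp (u *\<^sub>R Complex (- \<delta>) (y + 1))) = \<kappa> \<delta> \<beta> y"
proof -
  define z where "z = Complex (- \<delta>) (y + 1)"
  have z: "z \<noteq> 0" using assms by (simp add: z_def Complex_neg_nonzero)
  have "(LINT u:{0..\<beta>}|lborel. exp (u *\<^sub>R z)) = exp (\<beta> *\<^sub>R z) / z - exp (0 *\<^sub>R z) / z"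
    unfolding set_lebesgue_integral_def
  proof (rule integral_FTC_atLeastAtMost)
    show "((\<lambda>u. exp (u *\<^sub>R z) / z) has_vector_derivative exp (x *\<^sub>R z)) (at x within {0..\<beta>})" for x
      using has_vector_derivative_divide[OF exp_scaleR_has_vector_derivative_right[of z x "{0..\<beta>}"], of z] z
      by simp
  qed (use assms in \<open>auto intro!: continuous_intros\<close>)
  then show ?thesis by (simp add: \<kappa>_def z_def diff_divide_distrib)
qed

text \<open>A crude bound valid on the whole line, serving integrability; the decay on the half line
  is proved in \<open>test_function_bounds\<close>.\<close>

lemma norm_\<kappa>_le:
  assumes "\<delta> > 0" "\<beta> \<ge> 0"
  shows "norm (\<kappa> \<delta> \<beta> y) \<le> 2 / \<delta>"
proof -
  have "norm (exp (\<beta> *\<^sub>R Complex (- \<delta>) (y + 1)) - 1) \<le> exp (- (\<beta> * \<delta>)) + 1"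
    using norm_triangle_ineq4[of "exp (\<beta> *\<^sub>R Complex (- \<delta>) (y + 1))" 1] by (simp add: norm_exp_eq_Re)
  also have "\<dots> \<le> 2" using assms by simp
  finally have "norm (exp (\<beta> *\<^sub>R Complex (- \<delta>) (y + 1)) - 1) \<le> 2" .
  moreover have "\<delta> \<le> norm (Complex (- \<delta>) (y + 1))"
    using abs_Re_le_cmod[of "Complex (- \<delta>) (y + 1)"] assms by simp
  ultimately show ?thesis
    unfolding \<kappa>_def norm_divide using assms by (intro frac_le) auto
qed

text \<open>With \<open>M\<close> Lebesgue measure on \<open>\<Omega>\<close> and
  \<open>Y x = \<rho> * (b - x \<bullet> \<Theta>)\<close>, the case \<open>j = 0\<close> is the
  Fourier transform of \<open>\<Omega>\<close> at
  \<open>(s * \<rho> / (2 * pi)) *\<^sub>R \<Theta>\<close> up to a phase, while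
  \<open>s = \<alpha>\<close>, \<open>j = N\<close> is the pairing with the test function.\<close>

definition osc :: "'a measure \<Rightarrow> ('a \<Rightarrow> real) \<Rightarrow> real \<Rightarrow> real \<Rightarrow> nat \<Rightarrow> real \<Rightarrow> complex" where
  "osc M Y \<delta> \<beta> j s = (LINT x|M. exp (\<i> * of_real (s * Y x)) * \<kappa> \<delta> \<beta> (Y x) ^ j)"

section \<open>Passing from powers of the kernel to the plain transform\<close>

context finite_measure
begin

lemma measurable_osc[measurable]:
  assumes [measurable]: "Y \<in> borel_measurable M"
  shows "osc M Y \<delta> \<beta> j \<in> borel_measurable borel"
  unfolding osc_def[abs_def] by (rule borel_measurable_lebesgue_integral) measurable

lemma integrable_osc:
  assumes [measurable]: "Y \<in> borel_measurable M" and "\<delta> > 0" "\<beta> \<ge> 0"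
  shows "integrable M (\<lambda>x. exp (\<i> * of_real (s * Y x)) * \<kappa> \<delta> \<beta> (Y x) ^ j)"
  by (rule integrable_const_bound[where B="(2 / \<delta>) ^ j"])
    (auto simp: norm_mult norm_power intro!: power_mono norm_\<kappa>_le assms)

lemma norm_osc_le:
  assumes "Y \<in> borel_measurable M" and "\<delta> > 0" "\<beta> \<ge> 0"
  shows "norm (osc M Y \<delta> \<beta> j s) \<le> (2 / \<delta>) ^ j * measure M (space M)"
proof -
  have "norm (osc M Y \<delta> \<beta> j s) \<le> (LINT x|M. norm (exp (\<i> * of_real (s * Y x)) * \<kappa> \<delta> \<beta> (Y x) ^ j))"
    unfolding osc_def by (rule integral_norm_bound)
  also have "\<dots> \<le> (LINT x|M. (2 / \<delta>) ^ j)"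
    using integrable_norm[OF integrable_osc[OF assms]]
    by (rule integral_mono) (auto simp: norm_mult norm_power intro!: power_mono norm_\<kappa>_le assms)
  finally show ?thesis by (simp add: mult.commute)
qed

text \<open>Multiplication by \<open>\<kappa>\<close> averages the transform over \<open>[s, s + \<beta>]\<close>, with weight of modulus at most 1.\<close>

lemma osc_Suc:
  assumes Y[measurable]: "Y \<in> borel_measurable M" and \<delta>: "\<delta> > 0" and \<beta>: "\<beta> \<ge> 0"
  shows "osc M Y \<delta> \<beta> (Suc j) s
    = (LINT u|restrict_space lborel {0..\<beta>}. exp (u *\<^sub>R Complex (- \<delta>) 1) * osc M Y \<delta> \<beta> j (s + u))"
proof -
  define L where "L = restrict_space lborel {0..\<beta>}"
  interpret L: finite_measure L
    unfolding L_def by (rule finite_measure_restrict_lborel_Icc)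
  interpret LM: pair_sigma_finite L M ..
  interpret LMf: finite_measure "L \<Otimes>\<^sub>M M"
    by (rule finite_measure_pair_measure) unfold_locales
  have [measurable]: "(\<lambda>u. u) \<in> borel_measurable L"
    unfolding L_def by (rule measurable_restrict_space1) simp
  define F where "F u x = exp (u *\<^sub>R Complex (- \<delta>) 1) *
    (exp (\<i> * of_real ((s + u) * Y x)) * \<kappa> \<delta> \<beta> (Y x) ^ j)" for u x
  \<comment> \<open>The factors depending on \<open>u\<close> combine to the integrand of
    \<open>\<kappa>\<close>, so integrating in \<open>u\<close> first produces one more power of
    \<open>\<kappa>\<close>.\<close>
  have F: "F u x = exp (\<i> * of_real (s * Y x)) * \<kappa> \<delta> \<beta> (Y x) ^ j * exp (u *\<^sub>R Complex (- \<delta>) (Y x + 1))" for u x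
    by (simp add: F_def mult_exp_exp Complex_eq scaleR_conv_of_real algebra_simps)
  have int: "integrable (L \<Otimes>\<^sub>M M) (case_prod F)"
  proof (rule LMf.integrable_const_bound[where B="(2 / \<delta>) ^ j"])
    show "case_prod F \<in> borel_measurable (L \<Otimes>\<^sub>M M)"
      unfolding F_def by measurable
    show "AE z in L \<Otimes>\<^sub>M M. norm (case_prod F z) \<le> (2 / \<delta>) ^ j"
    proof (rule AE_I2, clarify)
      fix u x assume "(u, x) \<in> space (L \<Otimes>\<^sub>M M)"
      then have "u \<ge> 0" by (simp add: space_pair_measure L_def space_restrict_space)
      then have "norm (exp (u *\<^sub>R Complex (- \<delta>) 1)) \<le> 1"
        using \<delta> by (simp add: norm_exp_eq_Re)
      then have "norm (F u x) \<le> 1 * (1 * (2 / \<delta>) ^ j)"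
        unfolding F_def norm_mult norm_power
        using \<delta> \<beta> by (intro mult_mono power_mono norm_\<kappa>_le) auto
      then show "norm (F u x) \<le> (2 / \<delta>) ^ j" by simp
    qed
  qed
  have "osc M Y \<delta> \<beta> (Suc j) s = (LINT x|M. LINT u|L. F u x)"
    unfolding osc_def
  proof (intro Bochner_Integration.integral_cong refl)
    fix x
    have "(LINT u|L. exp (u *\<^sub>R Complex (- \<delta>) (Y x + 1))) = \<kappa> \<delta> \<beta> (Y x)"
      using \<kappa>_integral[OF \<delta> \<beta>, of "Y x"]
      by (simp add: L_def integral_restrict_space set_lebesgue_integral_def)
    then show "exp (\<i> * of_real (s * Y x)) * \<kappa> \<delta> \<beta> (Y x) ^ Suc j = (LINT u|L. F u x)"
      unfolding F by simp
  qed
  also have "\<dots> = (LINT u|L. LINT x|M. F u x)"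
    by (rule LM.Fubini_integral[OF int])
  also have "\<dots> = (LINT u|L. exp (u *\<^sub>R Complex (- \<delta>) 1) * osc M Y \<delta> \<beta> j (s + u))"
    by (simp add: F_def osc_def)
  finally show ?thesis by (simp add: L_def)
qed

lemma norm_osc_Suc_le:
  assumes Y[measurable]: "Y \<in> borel_measurable M" and \<delta>: "\<delta> > 0" and \<beta>: "\<beta> \<ge> 0"
  shows "norm (osc M Y \<delta> \<beta> (Suc j) s)
    \<le> (LINT u|restrict_space lborel {0..\<beta>}. norm (osc M Y \<delta> \<beta> j (s + u)))"
proof -
  define L where "L = restrict_space lborel {0..\<beta>}"
  interpret L: finite_measure L
    unfolding L_def by (rule finite_measure_restrict_lborel_Icc)
  have [measurable]: "(\<lambda>u. u) \<in> borel_measurable L"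
    unfolding L_def by (rule measurable_restrict_space1) simp
  have bound: "norm (exp (u *\<^sub>R Complex (- \<delta>) 1) * osc M Y \<delta> \<beta> j (s + u)) \<le> norm (osc M Y \<delta> \<beta> j (s + u))"
    if "u \<in> space L" for u
    using that \<delta> by (auto simp: L_def space_restrict_space norm_mult norm_exp_eq_Re intro!: mult_left_le_one_le)
  have int: "integrable L (\<lambda>u. norm (osc M Y \<delta> \<beta> j (s + u)))"
    by (rule L.integrable_const_bound[where B="(2 / \<delta>) ^ j * measure M (space M)"])
      (use norm_osc_le[OF Y \<delta> \<beta>] in auto)
  have "norm (osc M Y \<delta> \<beta> (Suc j) s) \<le> (LINT u|L. norm (exp (u *\<^sub>R Complex (- \<delta>) 1) * osc M Y \<delta> \<beta> j (s + u)))"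
    unfolding osc_Suc[OF Y \<delta> \<beta>] L_def[symmetric] by (rule integral_norm_bound)
  also have "\<dots> \<le> (LINT u|L. norm (osc M Y \<delta> \<beta> j (s + u)))"
    using bound by (intro integral_mono int Bochner_Integration.integrable_bound[OF int]) auto
  finally show ?thesis by (simp add: L_def)
qed

text \<open>Each averaging step lengthens the frequency window by \<open>\<beta>\<close>.
  Cauchy--Schwarz is applied only in the first step and costs one factor \<open>\<beta>\<close>;
  every further step averages a uniform bound and costs \<open>\<beta>\<close> in norm, that is
  \<open>\<beta>\<^sup>2\<close> after squaring.\<close>

lemma norm_osc_Suc_square_le:
  fixes \<beta> \<delta> :: real
  assumes Y[measurable]: "Y \<in> borel_measurable M" and \<delta>: "\<delta> > 0" and \<beta>: "\<beta> \<ge> 0"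
  shows "(norm (osc M Y \<delta> \<beta> (Suc j) s))\<^sup>2
    \<le> \<beta> ^ (2 * j + 1) * (LINT v:{s..s + Suc j * \<beta>}|lborel. (norm (osc M Y \<delta> \<beta> 0 v))\<^sup>2)"
proof (induction j arbitrary: s)
  case 0
  define L where "L = restrict_space lborel {0..\<beta>}"
  interpret L: finite_measure L
    unfolding L_def by (rule finite_measure_restrict_lborel_Icc)
  have [measurable]: "(\<lambda>u. u) \<in> borel_measurable L"
    unfolding L_def by (rule measurable_restrict_space1) simp
  have le: "norm (osc M Y \<delta> \<beta> 0 v) \<le> measure M (space M)" for v
    using norm_osc_le[OF Y \<delta> \<beta>, of 0 v] by simp
  have "(norm (osc M Y \<delta> \<beta> (Suc 0) s))\<^sup>2 \<le> (LINT u|L. norm (osc M Y \<delta> \<beta> 0 (s + u)))\<^sup>2"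
    using norm_osc_Suc_le[OF Y \<delta> \<beta>] by (intro power_mono) (auto simp: L_def)
  also have "\<dots> \<le> measure L (space L) * (LINT u|L. (norm (osc M Y \<delta> \<beta> 0 (s + u)))\<^sup>2)"
  proof (rule L.square_integral_le)
    show "integrable L (\<lambda>u. norm (osc M Y \<delta> \<beta> 0 (s + u)))"
      by (rule L.integrable_const_bound[where B="measure M (space M)"]) (use le in auto)
    show "integrable L (\<lambda>u. (norm (osc M Y \<delta> \<beta> 0 (s + u)))\<^sup>2)"
      by (rule L.integrable_const_bound[where B="(measure M (space M))\<^sup>2"])
        (use le in \<open>auto intro!: power_mono\<close>)
  qed
  also have "measure L (space L) = \<beta>"
    using \<beta> by (simp add: L_def space_restrict_space measure_restrict_space)
  also have "(LINT u|L. (norm (osc M Y \<delta> \<beta> 0 (s + u)))\<^sup>2) = (LINT v:{s..s + \<beta>}|lborel. (norm (osc M Y \<delta> \<beta> 0 v))\<^sup>2)"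
    using set_integral_shift[of \<beta> "\<lambda>v. (norm (osc M Y \<delta> \<beta> 0 v))\<^sup>2" s]
    by (simp add: L_def integral_restrict_space set_lebesgue_integral_def)
  finally show ?case by simp
next
  case (Suc j)
  define J where "J = (LINT v:{s..s + Suc (Suc j) * \<beta>}|lborel. (norm (osc M Y \<delta> \<beta> 0 v))\<^sup>2)"
  define L where "L = restrict_space lborel {0..\<beta>}"
  interpret L: finite_measure L
    unfolding L_def by (rule finite_measure_restrict_lborel_Icc)
  have [measurable]: "(\<lambda>u. u) \<in> borel_measurable L"
    unfolding L_def by (rule measurable_restrict_space1) simp
  have le: "norm (osc M Y \<delta> \<beta> 0 v) \<le> measure M (space M)" for v
    using norm_osc_le[OF Y \<delta> \<beta>, of 0 v] by simp
  have sint: "set_integrable lborel {a..b} (\<lambda>v. (norm (osc M Y \<delta> \<beta> 0 v))\<^sup>2)" for a b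
    unfolding set_integrable_def
  proof (rule integrableI_bounded_set_indicator[where B="(measure M (space M))\<^sup>2"])
    show "emeasure lborel {a..b} < \<infinity>" by (simp add: emeasure_lborel_Icc_eq)
  qed (use le in \<open>auto intro!: power_mono\<close>)
  have J0: "J \<ge> 0" unfolding J_def set_lebesgue_integral_def by simp
  \<comment> \<open>All windows starting at \<open>s + u\<close> lie in the window of
    \<open>J\<close>, so the induction hypothesis yields one bound for all \<open>u\<close>.\<close>
  have step: "norm (osc M Y \<delta> \<beta> (Suc j) (s + u)) \<le> sqrt (\<beta> ^ (2 * j + 1) * J)" if "u \<in> {0..\<beta>}" for u
  proof (rule real_le_rsqrt)
    have "(LINT v:{s + u..s + u + Suc j * \<beta>}|lborel. (norm (osc M Y \<delta> \<beta> 0 v))\<^sup>2) \<le> J"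
      unfolding J_def
      set_lebesgue_integral_def
    proof (rule integral_mono)
      have "{s + u..s + u + Suc j * \<beta>} \<subseteq> {s..s + Suc (Suc j) * \<beta>}"
        using that by (auto simp: algebra_simps)
      then show "indicator {s + u..s + u + Suc j * \<beta>} v *\<^sub>R (norm (osc M Y \<delta> \<beta> 0 v))\<^sup>2
        \<le> indicator {s..s + Suc (Suc j) * \<beta>} v *\<^sub>R (norm (osc M Y \<delta> \<beta> 0 v))\<^sup>2" for v
        by (auto simp: indicator_def)
    qed (use sint in \<open>simp_all add: set_integrable_def\<close>)
    then have "\<beta> ^ (2 * j + 1) * (LINT v:{s + u..s + u + Suc j * \<beta>}|lborel. (norm (osc M Y \<delta> \<beta> 0 v))\<^sup>2) \<le> \<beta> ^ (2 * j + 1) * J"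
      using \<beta> by (intro mult_left_mono) auto
    with Suc.IH[of "s + u"] show "(norm (osc M Y \<delta> \<beta> (Suc j) (s + u)))\<^sup>2 \<le> \<beta> ^ (2 * j + 1) * J"
      by linarith
  qed
  have "norm (osc M Y \<delta> \<beta> (Suc (Suc j)) s) \<le> (LINT u|L. norm (osc M Y \<delta> \<beta> (Suc j) (s + u)))"
    using norm_osc_Suc_le[OF Y \<delta> \<beta>] by (simp add: L_def)
  also have "\<dots> \<le> (LINT u|L. sqrt (\<beta> ^ (2 * j + 1) * J))"
  proof (rule integral_mono)
    show "integrable L (\<lambda>u. norm (osc M Y \<delta> \<beta> (Suc j) (s + u)))"
      by (rule L.integrable_const_bound[where B="(2 / \<delta>) ^ Suc j * measure M (space M)"])
        (use norm_osc_le[OF Y \<delta> \<beta>] in \<open>auto simp del: power_Suc\<close>)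
    show "integrable L (\<lambda>u. sqrt (\<beta> ^ (2 * j + 1) * J))" by (rule L.integrable_const)
  qed (use step in \<open>auto simp: L_def space_restrict_space\<close>)
  also have "\<dots> = \<beta> * sqrt (\<beta> ^ (2 * j + 1) * J)"
    using \<beta> by (simp add: L_def space_restrict_space measure_restrict_space)
  finally have "(norm (osc M Y \<delta> \<beta> (Suc (Suc j)) s))\<^sup>2 \<le> (\<beta> * sqrt (\<beta> ^ (2 * j + 1) * J))\<^sup>2"
    by (intro power_mono) auto
  also have "\<dots> = \<beta>\<^sup>2 * (\<beta> ^ (2 * j + 1) * J)"
    using \<beta> J0 by (simp add: power_mult_distrib)
  also have "\<dots> = \<beta> ^ (2 * Suc j + 1) * J"
    by (simp add: power2_eq_square)
  finally show ?case by (simp only: J_def)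
qed

end

section \<open>The test function at the edge of the support\<close>

text \<open>The normalized kernel \<open>w = (1 + y) * (- \<i>) * \<kappa> y\<close> is uniformly
  close to 1 for \<open>y \<ge> 0\<close>, hence so is \<open>w ^ N\<close>. This gives the upper
  bound everywhere; on \<open>[0, R]\<close> the slow factor
  \<open>exp (\<i> * \<alpha> * y)\<close> is close to 1 as well, which gives the sign.\<close>

lemma test_function_bounds:
  fixes R :: real
  assumes R: "R > 0"
  shows "\<exists>\<delta>>0. \<exists>\<beta>>0. \<exists>\<alpha>>0. \<forall>y\<ge>0.
    norm (exp (\<i> * of_real (\<alpha> * y)) * \<kappa> \<delta> \<beta> y ^ N) \<le> 2 / (1 + y) ^ N \<and>
    (y \<le> R \<longrightarrow> 1 / (2 * (1 + y) ^ N) \<le> Re ((- \<i>) ^ N * (exp (\<i> * of_real (\<alpha> * y)) * \<kappa> \<delta> \<beta> y ^ N)))"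
proof -
  have "isCont (\<lambda>w::complex. w ^ N) 1" by (intro continuous_intros)
  then obtain d where d: "d > 0" "\<And>w::complex. dist w 1 < d \<Longrightarrow> dist (w ^ N) (1 ^ N) < 1 / 4"
    unfolding continuous_at_eps_delta by (metis zero_less_divide_1_iff zero_less_numeral)
  \<comment> \<open>The distance of \<open>w\<close> from 1 will be at most
    \<open>2 * \<delta>\<close>, which has to be below \<open>d\<close>.\<close>
  define \<delta> where "\<delta> = d / 3"
  \<comment> \<open>Chosen so that \<open>exp (- (\<delta> * \<beta>)) \<le> \<delta>\<close>; the
    added 1 keeps \<open>\<beta>\<close> positive when \<open>ln \<delta> = 0\<close>.\<close>
  define \<beta> where "\<beta> = (\<bar>ln \<delta>\<bar> + 1) / \<delta>"
  \<comment> \<open>Makes \<open>\<alpha> * y \<le> 1 / 4\<close> on \<open>[0, R]\<close>.\<close>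
  define \<alpha> where "\<alpha> = 1 / (4 * R)"
  have pos: "\<delta> > 0" "\<beta> > 0" "\<alpha> > 0"
    using d R by (simp_all add: \<delta>_def \<beta>_def \<alpha>_def divide_pos_pos add_nonneg_pos)
  have "exp (- (\<delta> * \<beta>)) \<le> exp (ln \<delta>)"
    unfolding exp_le_cancel_iff using pos by (simp add: \<beta>_def)
  then have e: "exp (- (\<delta> * \<beta>)) \<le> \<delta>" using pos by simp
  have *: "norm (exp (\<i> * of_real (\<alpha> * y)) * \<kappa> \<delta> \<beta> y ^ N) \<le> 2 / (1 + y) ^ N \<and>
    (y \<le> R \<longrightarrow> 1 / (2 * (1 + y) ^ N) \<le> Re ((- \<i>) ^ N * (exp (\<i> * of_real (\<alpha> * y)) * \<kappa> \<delta> \<beta> y ^ N)))"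
    if y: "y \<ge> 0" for y
  proof -
    define z where "z = Complex (- \<delta>) (y + 1)"
    define q where "q = exp (\<beta> *\<^sub>R z)"
    have z: "z \<noteq> 0" using pos by (simp add: z_def Complex_neg_nonzero)
    define w where "w = of_real (1 + y) * (- \<i>) * \<kappa> \<delta> \<beta> y"
    \<comment> \<open>The main term cancels because \<open>\<i> * (1 + y) - z = \<delta>\<close>.
      What remains is the truncation error with \<open>q\<close> and the damping error
      \<open>\<delta>\<close>, both divided by \<open>z\<close> with
      \<open>norm z \<ge> 1 + y\<close>.\<close>
    have "w - 1 = (- (of_real (1 + y) * \<i> * q) + of_real \<delta>) / z"
      using z unfolding w_def \<kappa>_def z_def[symmetric] q_def[symmetric]
      by (simp add: field_simps) (simp add: z_def complex_eq_iff)
    then have "norm (w - 1) = norm (- (of_real (1 + y) * \<i> * q) + of_real \<delta>) / norm z"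
      by (simp add: norm_divide)
    also have "\<dots> \<le> ((1 + y) * \<delta> + \<delta>) / (1 + y)"
    proof (rule frac_le)
      have "norm q \<le> \<delta>" using e by (simp add: q_def z_def norm_exp_eq_Re mult.commute)
      moreover have "norm (of_real (1 + y) * \<i> * q) = (1 + y) * norm q"
        using y by (simp only: norm_mult norm_of_real norm_ii)
      ultimately have "norm (of_real (1 + y) * \<i> * q) \<le> (1 + y) * \<delta>"
        using y by (simp add: mult_left_mono)
      then show "norm (- (of_real (1 + y) * \<i> * q) + of_real \<delta>) \<le> (1 + y) * \<delta> + \<delta>"
        using norm_triangle_ineq[of "- (of_real (1 + y) * \<i> * q)" "of_real \<delta>"] pos by simp
      show "1 + y \<le> norm z"
        using abs_Im_le_cmod[of z] y by (simp add: z_def)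
    qed (use y pos in auto)
    also have "\<dots> \<le> \<delta> + \<delta>"
      using y pos by (simp add: field_simps)
    also have "\<dots> < d" using d by (simp add: \<delta>_def)
    finally have "dist w 1 < d" by (simp add: dist_norm)
    then have w1: "norm (w ^ N - 1) < 1 / 4" using d(2)[of w] by (simp add: dist_norm)
    have ww: "w ^ N = of_real ((1 + y) ^ N) * ((- \<i>) ^ N * \<kappa> \<delta> \<beta> y ^ N)"
      by (simp only: w_def power_mult_distrib mult.assoc of_real_power)
    have "norm (w ^ N) \<le> 2"
      using w1 norm_triangle_sub[of "w ^ N" 1] by simp
    moreover have "norm (w ^ N) = (1 + y) ^ N * norm ((- \<i>) ^ N * \<kappa> \<delta> \<beta> y ^ N)"
      unfolding ww norm_mult norm_of_real using y by simp
    ultimately have "(1 + y) ^ N * norm (\<kappa> \<delta> \<beta> y ^ N) \<le> 2"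
      by (simp add: norm_mult norm_power)
    then have 1: "norm (exp (\<i> * of_real (\<alpha> * y)) * \<kappa> \<delta> \<beta> y ^ N) \<le> 2 / (1 + y) ^ N"
      using y by (simp add: norm_mult field_simps)
    have 2: "1 / (2 * (1 + y) ^ N) \<le> Re ((- \<i>) ^ N * (exp (\<i> * of_real (\<alpha> * y)) * \<kappa> \<delta> \<beta> y ^ N))"
      if "y \<le> R"
    proof -
      define u where "u = exp (\<i> * of_real (\<alpha> * y))"
      have "norm (u - 1) = 2 * \<bar>sin (\<alpha> * y / 2)\<bar>"
        unfolding u_def by (rule dist_exp_i_1)
      also have "\<dots> \<le> \<bar>\<alpha> * y\<bar>" using abs_sin_x_le_abs_x[of "\<alpha> * y / 2"] by simp
      also have "\<dots> \<le> 1 / 4" using y R that by (simp add: \<alpha>_def abs_mult field_simps)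
      finally have u: "norm (u - 1) \<le> 1 / 4" .
      have "norm u = 1" by (simp add: u_def)
      then have "norm (u * (w ^ N - 1)) \<le> 1 / 4"
        using w1 by (simp add: norm_mult)
      \<comment> \<open>The sum inside the norm is \<open>u * w ^ N - 1\<close>; two errors of
        \<open>1 / 4\<close> leave real part at least \<open>1 / 2\<close>.\<close>
      then have "norm (u * (w ^ N - 1) + (u - 1)) \<le> 1 / 4 + 1 / 4"
        using u by (rule norm_triangle_mono)
      then have "norm (u * w ^ N - 1) \<le> 1 / 2"
        by (simp add: algebra_simps)
      then have "1 / 2 \<le> Re (u * w ^ N)"
        using abs_Re_le_cmod[of "u * w ^ N - 1"] by simp
      also have "u * w ^ N = of_real ((1 + y) ^ N) * ((- \<i>) ^ N * (u * \<kappa> \<delta> \<beta> y ^ N))"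
        by (simp add: ww mult_ac)
      also have "Re \<dots> = (1 + y) ^ N * Re ((- \<i>) ^ N * (u * \<kappa> \<delta> \<beta> y ^ N))"
        by simp
      finally show ?thesis
        using y by (simp add: u_def field_simps)
    qed
    show ?thesis using 1 2 by blast
  qed
  show ?thesis using pos * by blast
qed

section \<open>Integrals of the section function near an end point\<close>

lemma integral_edge_power:
  fixes b \<rho> :: real
  assumes "\<rho> > 0"
  shows "has_bochner_integral lborel (\<lambda>t. indicator {b - 1 / \<rho>..b} t *\<^sub>R (\<rho> * (b - t)) ^ m) (1 / (\<rho> * (real m + 1)))"
proof -
  have "has_bochner_integral lborel (\<lambda>t. indicator {b - 1 / \<rho>..b} t *\<^sub>R (\<rho> * (b - t)) ^ m)
    (- ((\<rho> * (b - b)) ^ Suc m / (\<rho> * (real m + 1))) - - ((\<rho> * (b - (b - 1 / \<rho>))) ^ Suc m / (\<rho> * (real m + 1))))"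
  proof (rule has_bochner_integral_FTC_Icc)
    show "((\<lambda>t. - ((\<rho> * (b - t)) ^ Suc m / (\<rho> * (real m + 1)))) has_vector_derivative (\<rho> * (b - x)) ^ m)
      (at x within {b - 1 / \<rho>..b})" for x
    proof -
      have "((\<lambda>t. - ((\<rho> * (b - t)) ^ Suc m / (\<rho> * (real m + 1)))) has_real_derivative
        - (real (Suc m) * (\<rho> * (b - x)) ^ m * (- \<rho>) / (\<rho> * (real m + 1)))) (at x within {b - 1 / \<rho>..b})"
        using assms by (auto intro!: derivative_eq_intros simp del: power_Suc)
      moreover have "- (real (Suc m) * (\<rho> * (b - x)) ^ m * (- \<rho>) / (\<rho> * (real m + 1))) = (\<rho> * (b - x)) ^ m"
      proof -
        have "real m + 1 \<noteq> 0" by linarith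
        then show ?thesis using assms by (simp add: divide_simps)
      qed
      ultimately show ?thesis
        by (simp add: has_real_derivative_iff_has_vector_derivative del: power_Suc)
    qed
  qed (use assms in \<open>auto intro!: continuous_intros\<close>)
  then show ?thesis using assms by simp
qed

text \<open>The exponent 2 is what remains of the decay \<open>m + 2\<close> of the test function
  against growth of order \<open>m\<close> of the section function. The antiderivative is explicit,
  and its value at \<open>-a\<close> has a favourable sign; if the interval is empty the claim is
  trivial.\<close>

lemma integral_tail_le:
  fixes a b \<rho> R :: real
  assumes "\<rho> > 0" "R \<ge> 0"
  shows "integrable lborel (\<lambda>t. indicator {-a..b - R / \<rho>} t * (1 / (1 + \<rho> * (b - t))\<^sup>2))"
    and "(LINT t|lborel. indicator {-a..b - R / \<rho>} t * (1 / (1 + \<rho> * (b - t))\<^sup>2)) \<le> 1 / (\<rho> * (1 + R))"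
proof -
  have "integrable lborel (\<lambda>t. indicator {-a..b - R / \<rho>} t * (1 / (1 + \<rho> * (b - t))\<^sup>2)) \<and>
    (LINT t|lborel. indicator {-a..b - R / \<rho>} t * (1 / (1 + \<rho> * (b - t))\<^sup>2)) \<le> 1 / (\<rho> * (1 + R))"
  proof (cases "-a \<le> b - R / \<rho>")
    case True
    have pos: "1 + \<rho> * (b - t) > 0" if "t \<le> b - R / \<rho>" for t
    proof -
      have "R \<le> \<rho> * (b - t)" using that assms by (simp add: field_simps)
      then show ?thesis using assms by simp
    qed
    have "has_bochner_integral lborel (\<lambda>t. indicator {-a..b - R / \<rho>} t *\<^sub>R (1 / (1 + \<rho> * (b - t))\<^sup>2))
      (1 / (\<rho> * (1 + \<rho> * (b - (b - R / \<rho>)))) - 1 / (\<rho> * (1 + \<rho> * (b - - a))))"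
    proof (rule has_bochner_integral_FTC_Icc[OF True])
      show "((\<lambda>t. 1 / (\<rho> * (1 + \<rho> * (b - t)))) has_vector_derivative 1 / (1 + \<rho> * (b - x))\<^sup>2)
        (at x within {-a..b - R / \<rho>})" if "x \<le> b - R / \<rho>" for x
        unfolding has_real_derivative_iff_has_vector_derivative[symmetric]
        using assms pos[OF that]
        by (auto intro!: derivative_eq_intros simp: power2_eq_square divide_simps)
      show "continuous_on {-a..b - R / \<rho>} (\<lambda>t. 1 / (1 + \<rho> * (b - t))\<^sup>2)"
        using pos by (intro continuous_intros) force
    qed
    moreover have "1 / (\<rho> * (1 + \<rho> * (b - - a))) \<ge> 0"
      using pos[OF True] assms by simp
    ultimately show ?thesis
      using assms by (auto simp: has_bochner_integral_iff)
  qed (use assms in simp)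
  then show "integrable lborel (\<lambda>t. indicator {-a..b - R / \<rho>} t * (1 / (1 + \<rho> * (b - t))\<^sup>2))"
    "(LINT t|lborel. indicator {-a..b - R / \<rho>} t * (1 / (1 + \<rho> * (b - t))\<^sup>2)) \<le> 1 / (\<rho> * (1 + R))"
    by auto
qed

text \<open>The integrand is bounded below pointwise by a multiple of the edge profile
  \<open>f1\<close> minus a multiple of the tail profile \<open>f2\<close>. In terms of
  \<open>\<tau> = \<rho> * (b - t)\<close>, the range \<open>\<tau> \<le> 1\<close> supplies the
  gain, the range up to \<open>R\<close> is nonnegative and discarded, and beyond \<open>R\<close>
  only absolute values are used.\<close>

lemma edge_integral_lower_bound:
  fixes A g :: "real \<Rightarrow> real" and a b \<rho> R :: real and m :: nat
  assumes m: "m > 0" and \<rho>: "\<rho> > 0" and R: "R \<ge> 1"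
    and A: "\<And>t. A t \<ge> 0" "\<And>t. t \<notin> {-a..b} \<Longrightarrow> A t = 0"
    and A_low: "\<And>\<tau>. 0 < \<tau> \<Longrightarrow> \<tau> \<le> 1 \<Longrightarrow> \<tau> ^ m * A (b - 1 / \<rho>) \<le> A (b - \<tau> / \<rho>)"
    and A_up: "\<And>\<tau>. 0 \<le> \<tau> \<Longrightarrow> A (b - \<tau> / \<rho>) \<le> 2 ^ m * (1 + \<tau>) ^ m * A (b - 1 / \<rho>)"
    and g_low: "\<And>y. 0 \<le> y \<Longrightarrow> y \<le> R \<Longrightarrow> 1 / (2 * (1 + y) ^ (m + 2)) \<le> g y"
    and g_abs: "\<And>y. 0 \<le> y \<Longrightarrow> \<bar>g y\<bar> \<le> 2 / (1 + y) ^ (m + 2)"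
    and int: "integrable lborel (\<lambda>t. A t * g (\<rho> * (b - t)))"
  shows "A (b - 1 / \<rho>) / \<rho> * (1 / (2 ^ (m + 3) * (real m + 1)) - 2 ^ (m + 1) / (1 + R))
    \<le> (LINT t|lborel. A t * g (\<rho> * (b - t)))"
proof -
  define A0 where "A0 = A (b - 1 / \<rho>)"
  define f1 where "f1 t = indicator {b - 1 / \<rho>..b} t *\<^sub>R (\<rho> * (b - t)) ^ m" for t
  define f2 where "f2 t = indicator {-a..b - R / \<rho>} t * (1 / (1 + \<rho> * (b - t))\<^sup>2)" for t
  have A0: "A0 \<ge> 0" using A by (simp add: A0_def)
  have f1: "integrable lborel f1" "(LINT t|lborel. f1 t) = 1 / (\<rho> * (real m + 1))"
    using integral_edge_power[OF \<rho>, of b m] by (simp_all add: f1_def[abs_def] has_bochner_integral_iff)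
  have f2: "integrable lborel f2" "(LINT t|lborel. f2 t) \<le> 1 / (\<rho> * (1 + R))"
    using integral_tail_le[OF \<rho>, of R a b] R by (simp_all add: f2_def[abs_def])
  have pw: "A0 * (f1 t / 2 ^ (m + 3) - 2 ^ (m + 1) * f2 t) \<le> A t * g (\<rho> * (b - t))" for t
  proof -
    define \<tau> where "\<tau> = \<rho> * (b - t)"
    have t: "t = b - \<tau> / \<rho>" using \<rho> by (simp add: \<tau>_def)
    have f2_nonneg: "f2 t \<ge> 0" by (simp add: f2_def)
    consider "t \<notin> {-a..b}" | "t \<in> {-a..b}" "\<tau> \<le> 1" | "t \<in> {-a..b}" "1 < \<tau>" "\<tau> \<le> R" | "t \<in> {-a..b}" "R < \<tau>"
      by force
    then show ?thesis
    proof cases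
      case 1
      \<comment> \<open>A point of \<open>{b - 1 / \<rho>..b}\<close> outside \<open>{-a..b}\<close>
        lies below \<open>-a\<close>. There \<open>A\<close> vanishes, and \<open>A_low\<close>
        forces the product to vanish; at \<open>t = b\<close>, where \<open>A_low\<close> says
        nothing, \<open>f1\<close> is 0 because \<open>m > 0\<close>.\<close>
      have "A0 * f1 t = 0"
      proof (cases "t \<in> {b - 1 / \<rho>..b}")
        case True
        show ?thesis
        proof (cases "t = b")
          case False
          then have "0 < \<tau>" "\<tau> \<le> 1" using True \<rho> by (auto simp: \<tau>_def field_simps)
          then have "\<tau> ^ m * A0 \<le> 0" using A_low[of \<tau>] A(2)[OF 1] t by (simp add: A0_def)
          then have "\<tau> ^ m * A0 = 0" using A0 \<open>0 < \<tau>\<close> by (smt (verit) mult_nonneg_nonneg zero_le_power)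
          then show ?thesis by (auto simp: f1_def \<tau>_def[symmetric])
        qed (use m in \<open>simp add: f1_def\<close>)
      qed (simp add: f1_def)
      then have "A0 * (f1 t / 2 ^ (m + 3)) = 0" by auto
      moreover have "0 \<le> A0 * (2 ^ (m + 1) * f2 t)" using A0 f2_nonneg by simp
      ultimately have "A0 * (f1 t / 2 ^ (m + 3) - 2 ^ (m + 1) * f2 t) \<le> 0"
        unfolding right_diff_distrib by linarith
      then show ?thesis using A(2)[OF 1] by simp
    next
      case 2
      have \<tau>0: "\<tau> \<ge> 0" using 2 \<rho> by (simp add: \<tau>_def)
      have "t \<in> {b - 1 / \<rho>..b}" using 2 \<rho> by (auto simp: \<tau>_def field_simps)
      then have f1t: "f1 t = \<tau> ^ m" by (simp add: f1_def \<tau>_def)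
      have "\<tau> ^ m * A0 \<le> A t"
      proof (cases "\<tau> = 0")
        case True then show ?thesis using m A(1)[of t] by (simp add: zero_power)
      next
        case False then show ?thesis using A_low[of \<tau>] 2 \<tau>0 t by (simp add: A0_def)
      qed
      \<comment> \<open>Here \<open>1 + \<tau> \<le> 2\<close>, so \<open>g_low\<close> gives
        \<open>1 / (2 * 2 ^ (m + 2))\<close>.\<close>
      moreover have "1 / 2 ^ (m + 3) \<le> g \<tau>"
      proof -
        have "2 * (1 + \<tau>) ^ (m + 2) \<le> 2 * 2 ^ (m + 2)"
          using \<tau>0 2 by (intro mult_left_mono power_mono) auto
        also have "\<dots> = (2::real) ^ (m + 3)" by (simp add: power_add)
        finally have "1 / 2 ^ (m + 3) \<le> 1 / (2 * (1 + \<tau>) ^ (m + 2))"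
          using \<tau>0 by (intro divide_left_mono) auto
        also have "\<dots> \<le> g \<tau>" using g_low[of \<tau>] \<tau>0 2 R by simp
        finally show ?thesis .
      qed
      ultimately have "(\<tau> ^ m * A0) * (1 / 2 ^ (m + 3)) \<le> A t * g \<tau>"
        using A \<tau>0 A0 by (intro mult_mono) auto
      moreover have "0 \<le> A0 * (2 ^ (m + 1) * f2 t)" using A0 f2_nonneg by simp
      moreover have "A0 * (\<tau> ^ m / 2 ^ (m + 3)) = (\<tau> ^ m * A0) * (1 / 2 ^ (m + 3))" by simp
      moreover have "A0 * (\<tau> ^ m / 2 ^ (m + 3) - 2 ^ (m + 1) * f2 t)
        = A0 * (\<tau> ^ m / 2 ^ (m + 3)) - A0 * (2 ^ (m + 1) * f2 t)"
        by (rule right_diff_distrib)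
      ultimately show ?thesis
        unfolding \<tau>_def[symmetric] f1t by linarith
    next
      case 3
      have "t \<notin> {b - 1 / \<rho>..b}" using 3 \<rho> by (auto simp: \<tau>_def field_simps)
      then have f1t: "f1 t = 0" by (simp add: f1_def)
      have "g \<tau> \<ge> 0"
        using 3 by (intro order_trans[OF _ g_low[of \<tau>]]) auto
      then have "0 \<le> A t * g \<tau>" using A(1)[of t] by simp
      moreover have "0 \<le> A0 * (2 ^ (m + 1) * f2 t)" using A0 f2_nonneg by simp
      moreover have "A0 * (0 / 2 ^ (m + 3) - 2 ^ (m + 1) * f2 t) = - (A0 * (2 ^ (m + 1) * f2 t))" by simp
      ultimately show ?thesis
        unfolding \<tau>_def[symmetric] f1t by linarith
    next
      case 4
      have "t \<notin> {b - 1 / \<rho>..b}" using 4 \<rho> R by (auto simp: \<tau>_def field_simps)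
      then have f1t: "f1 t = 0" by (simp add: f1_def)
      have "t \<in> {-a..b - R / \<rho>}" using 4 \<rho> by (auto simp: \<tau>_def field_simps)
      then have f2t: "f2 t = 1 / (1 + \<tau>)\<^sup>2" by (simp add: f2_def \<tau>_def)
      have \<tau>0: "\<tau> \<ge> 0" using 4 R by simp
      \<comment> \<open>The growth \<open>(1 + \<tau>) ^ m\<close> cancels all but two powers of the
        decay; the constants \<open>2 ^ m\<close> and 2 combine to
        \<open>2 ^ (m + 1)\<close>.\<close>
      have "A t * \<bar>g \<tau>\<bar> \<le> (2 ^ m * (1 + \<tau>) ^ m * A0) * (2 / (1 + \<tau>) ^ (m + 2))"
        using A_up[OF \<tau>0] g_abs[OF \<tau>0] t \<tau>0 A0 A(1)[of t] by (intro mult_mono) (auto simp: A0_def)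
      also have "\<dots> = A0 * (2 ^ (m + 1) * f2 t)"
      proof -
        have "(1 + \<tau>) ^ m \<noteq> 0" using \<tau>0 by simp
        then show ?thesis by (simp only: f2t power_add[of _ m 2]) simp
      qed
      finally have "A t * \<bar>g \<tau>\<bar> \<le> A0 * (2 ^ (m + 1) * f2 t)" .
      moreover have "- (A t * \<bar>g \<tau>\<bar>) \<le> A t * g \<tau>"
        using A(1)[of t] by (simp add: abs_if)
      moreover have "A0 * (0 / 2 ^ (m + 3) - 2 ^ (m + 1) * f2 t) = - (A0 * (2 ^ (m + 1) * f2 t))" by simp
      ultimately show ?thesis unfolding \<tau>_def[symmetric] f1t by linarith
    qed
  qed
  have "A0 / \<rho> * (1 / (2 ^ (m + 3) * (real m + 1)) - 2 ^ (m + 1) / (1 + R))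
    = A0 * (1 / (\<rho> * (real m + 1)) / 2 ^ (m + 3) - 2 ^ (m + 1) * (1 / (\<rho> * (1 + R))))"
  proof -
    have "A0 / \<rho> * (1 / (x * y) - w / z) = A0 * (1 / (\<rho> * y) / x - w * (1 / (\<rho> * z)))" for w x y z :: real
      by (simp add: divide_inverse algebra_simps)
    then show ?thesis .
  qed
  also have "\<dots> \<le> A0 * ((LINT t|lborel. f1 t) / 2 ^ (m + 3) - 2 ^ (m + 1) * (LINT t|lborel. f2 t))"
    unfolding f1(2) using f2(2) A0 by (intro mult_left_mono diff_left_mono) auto
  also have "\<dots> = (LINT t|lborel. A0 * (f1 t / 2 ^ (m + 3) - 2 ^ (m + 1) * f2 t))"
    using f1(1) f2(1) by simp
  also have "\<dots> \<le> (LINT t|lborel. A t * g (\<rho> * (b - t)))"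
    using f1(1) f2(1) by (intro integral_mono int pw) auto
  finally show ?thesis by (simp add: A0_def)
qed

section \<open>The lower bound\<close>

lemma cmod_fourier_transform_indicator_uminus:
  "cmod (fourier_transform (indicator \<Omega>) (- \<xi>)) = cmod (fourier_transform (indicator \<Omega>) \<xi>)"
proof -
  have "fourier_transform (indicator \<Omega>) (- \<xi>) = cnj (fourier_transform (indicator \<Omega>) \<xi>)"
    unfolding fourier_transform_def Bochner_Integration.integral_cnj[symmetric]
    by (intro Bochner_Integration.integral_cong) (auto simp: exp_cnj indicator_def)
  then show ?thesis by simp
qed

lemma parallel_section_eq_0: "(\<And>x. x \<in> \<Omega> \<Longrightarrow> x \<bullet> \<Theta> \<noteq> t) \<Longrightarrow> parallel_section \<Omega> \<Theta> t = 0"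
proof -
  assume "\<And>x. x \<in> \<Omega> \<Longrightarrow> x \<bullet> \<Theta> \<noteq> t"
  then have "\<Omega> \<inter> {x. x \<bullet> \<Theta> = t} = {}" by auto
  then show ?thesis by (simp add: parallel_section_def)
qed

text \<open>Positive volume makes some section at a height \<open>t0\<close> positive. Cones over
  that slice with apex at \<open>q\<close> or \<open>p\<close> spread positivity to every height
  strictly between the two extremes.\<close>

lemma closure_parallel_section_support:
  fixes \<Omega> :: "'a::euclidean_space set"
  assumes \<Omega>: "compact \<Omega>" "convex \<Omega>" "interior \<Omega> \<noteq> {}" and \<Theta>: "norm \<Theta> = 1"
    and p: "p \<in> \<Omega>" "\<And>x. x \<in> \<Omega> \<Longrightarrow> x \<bullet> \<Theta> \<le> p \<bullet> \<Theta>"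
    and q: "q \<in> \<Omega>" "\<And>x. x \<in> \<Omega> \<Longrightarrow> q \<bullet> \<Theta> \<le> x \<bullet> \<Theta>"
    and less: "q \<bullet> \<Theta> < p \<bullet> \<Theta>"
  shows "closure {t. parallel_section \<Omega> \<Theta> t \<noteq> 0} = {q \<bullet> \<Theta>..p \<bullet> \<Theta>}"
proof -
  let ?A = "parallel_section \<Omega> \<Theta>"
  have [measurable]: "\<Omega> \<in> sets borel" using \<Omega>(1) by (rule borel_compact)
  have out: "?A t = 0" if "t \<notin> {q \<bullet> \<Theta>..p \<bullet> \<Theta>}" for t
    using that p(2) q(2) by (intro parallel_section_eq_0) force
  \<comment> \<open>Otherwise the pushforward of the volume of \<open>\<Omega>\<close> has density
    0, although \<open>\<Omega>\<close> contains a ball.\<close>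
  obtain t0 where t0: "?A t0 > 0"
  proof (rule ccontr)
    assume "\<not> thesis"
    then have "?A t \<le> 0" for t using that by (meson not_le)
    then have "?A t = 0" for t using parallel_section_nonneg[of \<Omega> \<Theta> t] by (meson antisym)
    then have "emeasure (density lborel (\<lambda>t. ennreal (?A t))) UNIV = 0"
      by (simp add: emeasure_density)
    moreover have "emeasure (distr (density lborel (indicator \<Omega>)) borel (\<lambda>x. x \<bullet> \<Theta>)) UNIV = emeasure lborel \<Omega>"
      by (simp add: emeasure_distr emeasure_density)
    ultimately have "emeasure lborel \<Omega> = 0"
      using distr_inner_eq_parallel_section(2)[OF \<Omega>(1) \<Theta>] by simp
    moreover obtain c e where "e > 0" "ball c e \<subseteq> \<Omega>"
      using \<Omega>(3) by (auto simp: mem_interior)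
    moreover have "emeasure lborel (ball c e) \<le> emeasure lborel \<Omega>"
      using \<open>ball c e \<subseteq> \<Omega>\<close> by (intro emeasure_mono) auto
    ultimately show False
      using unit_ball_vol_pos[of "real DIM('a)", THEN less_imp_neq] by (simp add: emeasure_ball)
  qed
  have t0_in: "q \<bullet> \<Theta> \<le> t0" "t0 \<le> p \<bullet> \<Theta>" using out[of t0] t0 by auto
  have pos: "?A t \<noteq> 0" if "q \<bullet> \<Theta> < t" "t < p \<bullet> \<Theta>" for t
  proof -
    \<comment> \<open>The apex \<open>z\<close> is the extreme point on the same side of
      \<open>t0\<close> as \<open>t\<close>.\<close>
    have "\<exists>z\<in>\<Omega>. \<exists>\<theta>>0. \<theta> \<le> 1 \<and> t = (1 - \<theta>) * (z \<bullet> \<Theta>) + \<theta> * t0"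
    proof (cases "t \<le> t0")
      case True
      define \<theta> where "\<theta> = (t - q \<bullet> \<Theta>) / (t0 - q \<bullet> \<Theta>)"
      have "t = q \<bullet> \<Theta> + \<theta> * (t0 - q \<bullet> \<Theta>)" "0 < \<theta>" "\<theta> \<le> 1"
        using True that by (auto simp: \<theta>_def divide_le_eq_1)
      then have "t = (1 - \<theta>) * (q \<bullet> \<Theta>) + \<theta> * t0" by (simp add: algebra_simps)
      with \<open>0 < \<theta>\<close> \<open>\<theta> \<le> 1\<close> show ?thesis using q(1) by blast
    next
      case False
      define \<theta> where "\<theta> = (p \<bullet> \<Theta> - t) / (p \<bullet> \<Theta> - t0)"
      have "t = p \<bullet> \<Theta> - \<theta> * (p \<bullet> \<Theta> - t0)" "0 < \<theta>" "\<theta> \<le> 1"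
        using False that by (auto simp: \<theta>_def divide_le_eq_1)
      then have "t = (1 - \<theta>) * (p \<bullet> \<Theta>) + \<theta> * t0" by (simp add: algebra_simps)
      with \<open>0 < \<theta>\<close> \<open>\<theta> \<le> 1\<close> show ?thesis using p(1) by blast
    qed
    then obtain z \<theta> where "z \<in> \<Omega>" "0 < \<theta>" "\<theta> \<le> 1" "t = (1 - \<theta>) * (z \<bullet> \<Theta>) + \<theta> * t0" by blast
    then have "\<theta> ^ (DIM('a) - 1) * ?A t0 \<le> ?A t" "\<theta> ^ (DIM('a) - 1) * ?A t0 > 0"
      using parallel_section_cone[OF \<Omega>(1,2) \<Theta>] t0 by simp_all
    then show ?thesis by linarith
  qed
  show ?thesis
  proof (rule antisym)
    show "closure {t. ?A t \<noteq> 0} \<subseteq> {q \<bullet> \<Theta>..p \<bullet> \<Theta>}"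
      by (rule closure_minimal) (use out in blast, simp)
    have "closure {q \<bullet> \<Theta><..<p \<bullet> \<Theta>} \<subseteq> closure {t. ?A t \<noteq> 0}"
      by (rule closure_mono) (use pos in auto)
    then show "{q \<bullet> \<Theta>..p \<bullet> \<Theta>} \<subseteq> closure {t. ?A t \<noteq> 0}"
      using less by simp
  qed
qed

text \<open>The pairing of the section function with the test function is bounded below by
  \<open>edge_integral_lower_bound\<close> and above, after squaring, by
  \<open>norm_osc_Suc_square_le\<close>; rescaling the frequency turns the latter into the integral
  on the right. The lower bound \<open>2 / \<rho>\<close> on the width keeps the slice at depth
  \<open>1 / \<rho>\<close> away from the opposite end.\<close>

lemma fourier_transform_edge_bound:
  fixes \<Omega> :: "'a::euclidean_space set" and m :: nat and \<alpha> \<beta> \<delta> \<rho> R K :: real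
  defines "m \<equiv> DIM('a) - 1"
  assumes dim: "DIM('a) \<ge> 2"
    and \<Omega>: "compact \<Omega>" "convex \<Omega>" and \<Theta>: "norm \<Theta> = 1"
    and p: "p \<in> \<Omega>" "\<And>x. x \<in> \<Omega> \<Longrightarrow> x \<bullet> \<Theta> \<le> p \<bullet> \<Theta>"
    and q: "q \<in> \<Omega>" "\<And>x. x \<in> \<Omega> \<Longrightarrow> q \<bullet> \<Theta> \<le> x \<bullet> \<Theta>"
    and \<rho>: "\<rho> > 0" "2 / \<rho> \<le> p \<bullet> \<Theta> - q \<bullet> \<Theta>"
    and R: "R \<ge> 1" and \<delta>: "\<delta> > 0" and \<beta>: "\<beta> > 0"
    and norm_test: "\<And>y. y \<ge> 0 \<Longrightarrow> norm (exp (\<i> * of_real (\<alpha> * y)) * \<kappa> \<delta> \<beta> y ^ (m + 2)) \<le> 2 / (1 + y) ^ (m + 2)"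
    and Re_test: "\<And>y. y \<ge> 0 \<Longrightarrow> y \<le> R \<Longrightarrow>
      1 / (2 * (1 + y) ^ (m + 2)) \<le> Re ((- \<i>) ^ (m + 2) * (exp (\<i> * of_real (\<alpha> * y)) * \<kappa> \<delta> \<beta> y ^ (m + 2)))"
    and K: "K \<ge> 0" "K \<le> 1 / (2 ^ (m + 3) * (real m + 1)) - 2 ^ (m + 1) / (1 + R)"
  shows "K\<^sup>2 / (2 * pi * \<beta> ^ (2 * m + 3)) / \<rho> * (parallel_section \<Omega> \<Theta> (p \<bullet> \<Theta> - 1 / \<rho>))\<^sup>2
    \<le> (LINT s:{\<alpha> / (2 * pi) * \<rho>..(\<alpha> + real (m + 2) * \<beta>) / (2 * pi) * \<rho>}|lborel.
         (cmod (fourier_transform (indicator \<Omega>) (s *\<^sub>R \<Theta>)))\<^sup>2)"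
proof -
  define A where "A = parallel_section \<Omega> \<Theta>"
  define b where "b = p \<bullet> \<Theta>"
  define a where "a = - (q \<bullet> \<Theta>)"
  define N where "N = m + 2"
  define M where "M = density lborel (indicator \<Omega> :: 'a \<Rightarrow> ennreal)"
  define Y where "Y x = \<rho> * (b - x \<bullet> \<Theta>)" for x
  define g where "g y = Re ((- \<i>) ^ N * (exp (\<i> * of_real (\<alpha> * y)) * \<kappa> \<delta> \<beta> y ^ N))" for y
  have [measurable]: "\<Omega> \<in> sets borel" using \<Omega>(1) by (rule borel_compact)
  have M_real: "M = density lborel (\<lambda>x. ennreal (indicator \<Omega> x))"
    by (simp add: M_def ennreal_indicator)
  interpret finite_measure M
  proof (rule finite_measureI)
    have "emeasure M (space M) = emeasure lborel \<Omega>"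
      by (simp add: M_def emeasure_density)
    then show "emeasure M (space M) \<noteq> \<infinity>"
      using emeasure_bounded_finite[OF compact_imp_bounded[OF \<Omega>(1)]] by simp
  qed
  have [measurable_cong]: "sets M = sets borel" by (simp add: M_def)
  have Y[measurable]: "Y \<in> borel_measurable M" unfolding Y_def[abs_def] by measurable
  have [measurable]: "A \<in> borel_measurable borel"
    unfolding A_def by (rule borel_measurable_parallel_section[OF \<Omega>(1) \<Theta>])
  have [measurable]: "g \<in> borel_measurable borel" unfolding g_def[abs_def] by measurable
  note cone = parallel_section_cone[OF \<Omega> \<Theta>, folded A_def m_def]
  have A_nonneg: "A t \<ge> 0" for t by (simp add: A_def parallel_section_nonneg)
  have intM: "integrable M (\<lambda>x. exp (\<i> * of_real (\<alpha> * Y x)) * \<kappa> \<delta> \<beta> (Y x) ^ N)"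
    using \<delta> \<beta> by (intro integrable_osc) auto
  then have intg: "integrable M (\<lambda>x. g (Y x))"
    unfolding g_def by (intro integrable_Re integrable_mult_right)
  have distr: "distr M borel (\<lambda>x. x \<bullet> \<Theta>) = density lborel (\<lambda>t. ennreal (A t))"
    unfolding M_def A_def by (rule distr_inner_eq_parallel_section(2)[OF \<Omega>(1) \<Theta>])
  have "integrable (distr M borel (\<lambda>x. x \<bullet> \<Theta>)) (\<lambda>t. g (\<rho> * (b - t)))"
    using intg by (simp add: integrable_distr_eq Y_def)
  then have intA: "integrable lborel (\<lambda>t. A t * g (\<rho> * (b - t)))"
    unfolding distr using A_nonneg by (simp add: integrable_density)
  have "K * (A (b - 1 / \<rho>) / \<rho>) \<le> A (b - 1 / \<rho>) / \<rho> * (1 / (2 ^ (m + 3) * (real m + 1)) - 2 ^ (m + 1) / (1 + R))"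
    using K A_nonneg[of "b - 1 / \<rho>"] \<rho> by (subst mult.commute) (intro mult_left_mono, auto)
  also have "\<dots> \<le> (LINT t|lborel. A t * g (\<rho> * (b - t)))"
  proof (rule edge_integral_lower_bound[where a=a, OF _ \<rho>(1) R A_nonneg _ _ _ _ _ intA])
    show "m > 0" using dim by (simp add: m_def)
    show "A t = 0" if "t \<notin> {-a..b}" for t
      unfolding A_def using that p(2) q(2)
      by (intro parallel_section_eq_0) (force simp: a_def b_def)
    show "\<tau> ^ m * A (b - 1 / \<rho>) \<le> A (b - \<tau> / \<rho>)" if "0 < \<tau>" "\<tau> \<le> 1" for \<tau>
    proof -
      have "(1 - \<tau>) * b + \<tau> * (b - 1 / \<rho>) = b - \<tau> / \<rho>" by (simp add: algebra_simps)
      then show ?thesis using cone[OF p(1) that, of "b - 1 / \<rho>"] by (simp add: b_def)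
    qed
    show "A (b - \<tau> / \<rho>) \<le> 2 ^ m * (1 + \<tau>) ^ m * A (b - 1 / \<rho>)" if \<tau>: "0 \<le> \<tau>" for \<tau>
    proof (cases "\<tau> \<le> 1")
      \<comment> \<open>The slice closer to the edge is compared through a cone with apex
        \<open>q\<close> at the opposite end. Heights measured from \<open>- a\<close> shrink by the
        ratio \<open>\<theta>\<close>, and \<open>2 * u \<le> b + a\<close> gives
        \<open>\<theta> \<ge> 1 / 2\<close>, whence the factor \<open>2 ^ m\<close>.\<close>
      case True
      define u where "u = 1 / \<rho>"
      define v where "v = \<tau> / \<rho>"
      have uv: "v \<le> u" "0 \<le> v" "0 < u" "2 * u \<le> b + a"
        using True \<rho> \<tau> by (auto simp: u_def v_def a_def b_def intro: divide_right_mono)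
      define \<theta> where "\<theta> = (b + a - u) / (b + a - v)"
      have ne: "b + a - v > 0" using uv by linarith
      then have \<theta>: "1 / 2 \<le> \<theta>" "\<theta> \<le> 1"
        using uv by (simp_all add: \<theta>_def pos_le_divide_eq)
      have "(1 - \<theta>) * (q \<bullet> \<Theta>) + \<theta> * (b - \<tau> / \<rho>) = - a + \<theta> * (b + a - v)"
        by (simp add: a_def v_def algebra_simps)
      also have "\<dots> = b - 1 / \<rho>" using ne by (simp add: \<theta>_def u_def)
      finally have "\<theta> ^ m * A (b - \<tau> / \<rho>) \<le> A (b - 1 / \<rho>)"
        using cone[OF q(1), of \<theta> "b - \<tau> / \<rho>"] \<theta> by simp
      moreover have "(1 / 2) ^ m * A (b - \<tau> / \<rho>) \<le> \<theta> ^ m * A (b - \<tau> / \<rho>)"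
        using \<theta> A_nonneg by (intro mult_right_mono power_mono) auto
      ultimately have "(1 / 2) ^ m * A (b - \<tau> / \<rho>) \<le> A (b - 1 / \<rho>)"
        by linarith
      then have "A (b - \<tau> / \<rho>) \<le> 2 ^ m * A (b - 1 / \<rho>)"
        by (simp add: power_one_over field_simps)
      also have "\<dots> \<le> 2 ^ m * (1 + \<tau>) ^ m * A (b - 1 / \<rho>)"
        using \<tau> A_nonneg by (intro mult_right_mono) (auto simp: one_le_power)
      finally show ?thesis .
    next
      \<comment> \<open>For deeper slices the apex is \<open>p\<close> and the ratio is
        \<open>1 / \<tau>\<close>, which gives the factor \<open>\<tau> ^ m\<close>.\<close>
      case False
      have "(1 - 1 / \<tau>) * (p \<bullet> \<Theta>) + 1 / \<tau> * (b - \<tau> / \<rho>) = b - 1 / \<rho>"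
        using False by (simp add: b_def field_simps)
      then have "(1 / \<tau>) ^ m * A (b - \<tau> / \<rho>) \<le> A (b - 1 / \<rho>)"
        using cone[OF p(1), of "1 / \<tau>" "b - \<tau> / \<rho>"] False by simp
      then have "A (b - \<tau> / \<rho>) \<le> \<tau> ^ m * A (b - 1 / \<rho>)"
        using False by (simp add: power_one_over field_simps)
      also have "\<dots> \<le> 2 ^ m * (1 + \<tau>) ^ m * A (b - 1 / \<rho>)"
      proof (intro mult_right_mono A_nonneg)
        have "\<tau> ^ m \<le> (2 * (1 + \<tau>)) ^ m" using \<tau> by (intro power_mono) auto
        then show "\<tau> ^ m \<le> 2 ^ m * (1 + \<tau>) ^ m" by (simp only: power_mult_distrib)
      qed
      finally show ?thesis .
    qed
    show "1 / (2 * (1 + y) ^ (m + 2)) \<le> g y" if "0 \<le> y" "y \<le> R" for y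
      unfolding g_def N_def by (rule Re_test[OF that])
    show "\<bar>g y\<bar> \<le> 2 / (1 + y) ^ (m + 2)" if "0 \<le> y" for y
    proof -
      have "\<bar>g y\<bar> \<le> norm ((- \<i>) ^ N * (exp (\<i> * of_real (\<alpha> * y)) * \<kappa> \<delta> \<beta> y ^ N))"
        unfolding g_def by (rule abs_Re_le_cmod)
      also have "\<dots> = norm (exp (\<i> * of_real (\<alpha> * y)) * \<kappa> \<delta> \<beta> y ^ N)"
        by (simp add: norm_mult norm_power)
      also have "\<dots> \<le> 2 / (1 + y) ^ (m + 2)"
        unfolding N_def by (rule norm_test[OF that])
      finally show ?thesis .
    qed
  qed
  \<comment> \<open>Back from heights to points of \<open>\<Omega>\<close>, where the pairing is the
    real part of an \<open>osc\<close> integral rotated by a phase.\<close>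
  also have "\<dots> = (LINT t|distr M borel (\<lambda>x. x \<bullet> \<Theta>). g (\<rho> * (b - t)))"
    unfolding distr using A_nonneg by (simp add: integral_density)
  also have "\<dots> = (LINT x|M. g (Y x))"
    by (simp add: integral_distr Y_def)
  also have "\<dots> = Re ((- \<i>) ^ N * osc M Y \<delta> \<beta> N \<alpha>)"
    unfolding g_def osc_def integral_mult_right_zero[symmetric]
    by (rule integral_Re[OF integrable_mult_right[OF intM]])
  also have "\<dots> \<le> norm ((- \<i>) ^ N * osc M Y \<delta> \<beta> N \<alpha>)"
    by (rule complex_Re_le_cmod)
  also have "\<dots> = norm (osc M Y \<delta> \<beta> N \<alpha>)"
    by (simp add: norm_mult norm_power)
  finally have "(K * (A (b - 1 / \<rho>) / \<rho>))\<^sup>2 \<le> (norm (osc M Y \<delta> \<beta> N \<alpha>))\<^sup>2"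
    using K A_nonneg \<rho> by (intro power_mono) auto
  also have "\<dots> \<le> \<beta> ^ (2 * m + 3) * (LINT v:{\<alpha>..\<alpha> + real (m + 2) * \<beta>}|lborel. (norm (osc M Y \<delta> \<beta> 0 v))\<^sup>2)"
  proof -
    have eqs: "Suc (m + 1) = m + 2" "2 * (m + 1) + 1 = 2 * m + 3" by simp_all
    show ?thesis
      unfolding N_def by (rule norm_osc_Suc_square_le[OF Y \<delta> less_imp_le[OF \<beta>], of "m + 1" \<alpha>, unfolded eqs])
  qed
  also have "(LINT v:{\<alpha>..\<alpha> + real (m + 2) * \<beta>}|lborel. (norm (osc M Y \<delta> \<beta> 0 v))\<^sup>2)
    = 2 * pi / \<rho> * (LINT s:{\<alpha> / (2 * pi) * \<rho>..(\<alpha> + real (m + 2) * \<beta>) / (2 * pi) * \<rho>}|lborel.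
         (cmod (fourier_transform (indicator \<Omega>) (s *\<^sub>R \<Theta>)))\<^sup>2)"
  proof -
    define F where "F s = (cmod (fourier_transform (indicator \<Omega>) (s *\<^sub>R \<Theta>)))\<^sup>2" for s
    \<comment> \<open>The substitution is \<open>v = c * s\<close>. The end point \<open>b\<close>
      in \<open>Y\<close> contributes only a factor of modulus 1.\<close>
    define c where "c = 2 * pi / \<rho>"
    have c: "c > 0" using \<rho> by (simp add: c_def)
    have "norm (osc M Y \<delta> \<beta> 0 v) = cmod (fourier_transform (indicator \<Omega>) ((v / c) *\<^sub>R \<Theta>))" for v
    proof -
      have "osc M Y \<delta> \<beta> 0 v = (LINT x|lborel. indicator \<Omega> x *\<^sub>R exp (\<i> * of_real (v * Y x)))"
        unfolding osc_def M_real by (subst integral_density) auto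
      also have "\<dots> = (LINT x|lborel. exp (\<i> * of_real (v * \<rho> * b)) *
        (indicator \<Omega> x * exp (- 2 * of_real pi * \<i> * of_real (((v / c) *\<^sub>R \<Theta>) \<bullet> x))))"
      proof (intro Bochner_Integration.integral_cong refl)
        fix x
        have "\<i> * of_real (v * Y x) = \<i> * of_real (v * \<rho> * b) + - 2 * of_real pi * \<i> * of_real (((v / c) *\<^sub>R \<Theta>) \<bullet> x)"
          using \<rho> by (simp add: Y_def c_def inner_commute field_simps)
        then have "exp (\<i> * of_real (v * Y x)) = exp (\<i> * of_real (v * \<rho> * b)) *
          exp (- 2 * of_real pi * \<i> * of_real (((v / c) *\<^sub>R \<Theta>) \<bullet> x))"
          by (simp only: exp_add)
        then show "indicator \<Omega> x *\<^sub>R exp (\<i> * of_real (v * Y x)) = exp (\<i> * of_real (v * \<rho> * b)) *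
          (indicator \<Omega> x * exp (- 2 * of_real pi * \<i> * of_real (((v / c) *\<^sub>R \<Theta>) \<bullet> x)))"
          by (simp add: indicator_def)
      qed
      also have "\<dots> = exp (\<i> * of_real (v * \<rho> * b)) * fourier_transform (indicator \<Omega>) ((v / c) *\<^sub>R \<Theta>)"
        unfolding fourier_transform_def by (rule integral_mult_right_zero)
      finally show ?thesis by (simp add: norm_mult)
    qed
    then have "(LINT v:{\<alpha>..\<alpha> + real (m + 2) * \<beta>}|lborel. (norm (osc M Y \<delta> \<beta> 0 v))\<^sup>2)
      = (LINT v:{\<alpha>..\<alpha> + real (m + 2) * \<beta>}|lborel. F (v / c))"
      by (simp add: F_def)
    also have "\<dots> = c * (LINT s:{\<alpha> / c..(\<alpha> + real (m + 2) * \<beta>) / c}|lborel. F s)"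
      unfolding set_lebesgue_integral_def
      by (subst lborel_integral_real_affine[of c _ 0])
        (use c in \<open>auto intro!: Bochner_Integration.integral_cong simp: indicator_def field_simps\<close>)
    finally show ?thesis by (simp add: F_def c_def field_simps)
  qed
  finally show ?thesis
    using \<rho> \<beta> by (simp add: A_def b_def power_mult_distrib power_divide field_simps power2_eq_square)
qed

theorem theorem2p7:
  fixes \<Omega> :: "(real ^ 'd) set"
  assumes "CARD('d) \<ge> 2"
    and "convex_body \<Omega>"
    and "smooth_hypersurface (frontier \<Omega>)"
    and "finite_order_of_contact (frontier \<Omega>)"
    and "0 \<in> interior \<Omega>"
  shows "\<exists>\<alpha>>0. \<exists>\<beta>>0. \<exists>c>0. \<exists>C>0. \<forall>\<Theta>::real ^ 'd. norm \<Theta> = 1 \<longrightarrow>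
    (\<exists>a>0. \<exists>b>0.
      closure {t. parallel_section \<Omega> \<Theta> t \<noteq> 0} = {-a..b} \<and>
      (\<forall>\<rho>>c.
        (LINT s:{\<alpha> * \<rho>..\<beta> * \<rho>}|lborel.
           (cmod (fourier_transform (indicator \<Omega>) (s *\<^sub>R \<Theta>)))\<^sup>2)
        \<ge> C / \<rho> * ((parallel_section \<Omega> \<Theta> (-a + 1 / \<rho>))\<^sup>2 +
                   (parallel_section \<Omega> \<Theta> (b - 1 / \<rho>))\<^sup>2)))"
proof -
  have \<Omega>: "compact \<Omega>" "convex \<Omega>" "interior \<Omega> \<noteq> {}"
    using assms(2) by (auto simp: convex_body_def)
  obtain r where r: "r > 0" "cball 0 r \<subseteq> \<Omega>"
    using assms(5) by (auto simp: mem_interior_cball)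
  define m where "m = CARD('d) - 1"
  have m: "m = DIM(real ^ 'd) - 1" and dim: "DIM(real ^ 'd) \<ge> 2"
    using assms(1) by (simp_all add: m_def)
  \<comment> \<open>With this \<open>R\<close> the tail \<open>2 ^ (m + 1) / R\<close> equals
    \<open>K\<close>, which is half of the main term
    \<open>1 / (2 ^ (m + 3) * (real m + 1))\<close>; the difference is therefore at least
    \<open>K\<close>.\<close>
  define R :: real where "R = 2 ^ (2 * m + 5) * (real m + 1)"
  define K :: real where "K = 1 / (2 ^ (m + 4) * (real m + 1))"
  have R: "R \<ge> 1"
    unfolding R_def using mult_mono[of 1 "2 ^ (2 * m + 5)" 1 "real m + 1"]
    by (simp add: algebra_simps)
  have K: "K > 0" by (simp add: K_def add_pos_nonneg)
  have K_le: "K \<le> 1 / (2 ^ (m + 3) * (real m + 1)) - 2 ^ (m + 1) / (1 + R)"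
  proof -
    have "2 ^ (m + 1) / (1 + R) \<le> 2 ^ (m + 1) / R"
      using R by (intro divide_left_mono) auto
    also have "\<dots> = K"
    proof -
      have "(2::real) ^ (2 * m + 5) = 2 ^ (m + 1) * 2 ^ (m + 4)"
        by (simp only: power_add[symmetric]) simp
      then have "R = 2 ^ (m + 1) * (2 ^ (m + 4) * (real m + 1))" by (simp only: R_def mult.assoc)
      moreover have "x / (x * z) = 1 / z" if "x \<noteq> 0" for x z :: real using that by simp
      ultimately show ?thesis by (simp only: K_def) simp
    qed
    finally have "2 ^ (m + 1) / (1 + R) \<le> K" .
    moreover have "1 / (2 ^ (m + 3) * (real m + 1)) = 2 * K"
      unfolding K_def by (simp only: power_add) simp
    ultimately show ?thesis by linarith
  qed
  have "R > 0" using R by simp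
  \<comment> \<open>These parameters depend only on the dimension, so all constants below are
    uniform in \<open>\<Theta>\<close> and \<open>\<rho>\<close>.\<close>
  then obtain \<delta> \<beta> \<alpha> where pos: "\<delta> > 0" "\<beta> > 0" "\<alpha> > 0"
    and test: "\<forall>y\<ge>0. norm (exp (\<i> * of_real (\<alpha> * y)) * \<kappa> \<delta> \<beta> y ^ (m + 2)) \<le> 2 / (1 + y) ^ (m + 2) \<and>
      (y \<le> R \<longrightarrow> 1 / (2 * (1 + y) ^ (m + 2))
        \<le> Re ((- \<i>) ^ (m + 2) * (exp (\<i> * of_real (\<alpha> * y)) * \<kappa> \<delta> \<beta> y ^ (m + 2))))"
    using test_function_bounds[of R "m + 2"] by blast
  define \<alpha>' where "\<alpha>' = \<alpha> / (2 * pi)"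
  define \<beta>' where "\<beta>' = (\<alpha> + real (m + 2) * \<beta>) / (2 * pi)"
  define C where "C = K\<^sup>2 / (2 * pi * \<beta> ^ (2 * m + 3))"
  have C: "C > 0" using K pos by (simp add: C_def)
  have edge: "C / \<rho> * (parallel_section \<Omega> \<Theta> (p \<bullet> \<Theta> - 1 / \<rho>))\<^sup>2
    \<le> (LINT s:{\<alpha>' * \<rho>..\<beta>' * \<rho>}|lborel. (cmod (fourier_transform (indicator \<Omega>) (s *\<^sub>R \<Theta>)))\<^sup>2)"
    if "norm \<Theta> = 1" "p \<in> \<Omega>" "\<And>x. x \<in> \<Omega> \<Longrightarrow> x \<bullet> \<Theta> \<le> p \<bullet> \<Theta>" "q \<in> \<Omega>" "\<And>x. x \<in> \<Omega> \<Longrightarrow> q \<bullet> \<Theta> \<le> x \<bullet> \<Theta>"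
      "\<rho> > 0" "2 / \<rho> \<le> p \<bullet> \<Theta> - q \<bullet> \<Theta>" for \<Theta> p q :: "real ^ 'd" and \<rho> :: real
    unfolding C_def \<alpha>'_def \<beta>'_def
    using test dim K
    by (intro fourier_transform_edge_bound[where 'a = "real ^ 'd", folded m, OF _ \<Omega>(1,2) that R pos(1,2) _ _ _ K_le]) auto
  show ?thesis
  proof (rule exI[of _ \<alpha>'], intro conjI, goal_cases)
    case 2
    show ?case
    proof (rule exI[of _ \<beta>'], intro conjI, goal_cases)
      case 2
      show ?case
      \<comment> \<open>The ball of radius \<open>r\<close> in \<open>\<Omega>\<close> gives width
        at least \<open>2 * r\<close> in every direction, so \<open>\<rho> > 1 / r\<close> ensures
        the width condition of \<open>edge\<close>.\<close>
      proof (rule exI[of _ "1 / r"], intro conjI, goal_cases)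
        case 2
        show ?case
        \<comment> \<open>Both edge bounds have the same integral on the right, so their average
          bounds the sum of squares with half the constant.\<close>
        proof (rule exI[of _ "C / 2"], intro conjI allI impI, goal_cases)
          case (2 \<Theta>)
          have ne: "\<Omega> \<noteq> {}" using \<Omega>(3) interior_subset by blast
          have cont: "continuous_on \<Omega> (\<lambda>x. x \<bullet> \<Theta>)" by (intro continuous_intros)
          obtain p where p: "p \<in> \<Omega>" "\<And>x. x \<in> \<Omega> \<Longrightarrow> x \<bullet> \<Theta> \<le> p \<bullet> \<Theta>"
            using continuous_attains_sup[OF \<Omega>(1) ne cont] by blast
          obtain q where q: "q \<in> \<Omega>" "\<And>x. x \<in> \<Omega> \<Longrightarrow> q \<bullet> \<Theta> \<le> x \<bullet> \<Theta>"
            using continuous_attains_inf[OF \<Omega>(1) ne cont] by blast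
          have "r *\<^sub>R \<Theta> \<in> \<Omega>" "(- r) *\<^sub>R \<Theta> \<in> \<Omega>" using r 2 by (auto intro!: subsetD[OF r(2)])
          then have rp: "r \<le> p \<bullet> \<Theta>" and rq: "q \<bullet> \<Theta> \<le> - r"
            using p(2)[of "r *\<^sub>R \<Theta>"] q(2)[of "(- r) *\<^sub>R \<Theta>"] 2 by (auto simp: norm_eq_1)
          \<comment> \<open>The witness for \<open>a\<close> is
            \<open>- (q \<bullet> \<Theta>)\<close>, and the double negation is
            \<open>-a\<close>.\<close>
          have supp: "closure {t. parallel_section \<Omega> \<Theta> t \<noteq> 0} = {- (- (q \<bullet> \<Theta>))..p \<bullet> \<Theta>}"
            using closure_parallel_section_support[OF \<Omega> 2 p q] rp rq r by simp
          have bound: "C / 2 / \<rho> * ((parallel_section \<Omega> \<Theta> (- (- (q \<bullet> \<Theta>)) + 1 / \<rho>))\<^sup>2 +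
                   (parallel_section \<Omega> \<Theta> (p \<bullet> \<Theta> - 1 / \<rho>))\<^sup>2)
            \<le> (LINT s:{\<alpha>' * \<rho>..\<beta>' * \<rho>}|lborel. (cmod (fourier_transform (indicator \<Omega>) (s *\<^sub>R \<Theta>)))\<^sup>2)"
            if "\<rho> > 1 / r" for \<rho>
          proof -
            have \<rho>: "\<rho> > 0" using that r by (meson less_trans zero_less_divide_1_iff)
            then have "1 / \<rho> < r" using that r by (simp add: field_simps)
            then have "2 / \<rho> \<le> p \<bullet> \<Theta> - q \<bullet> \<Theta>" using rp rq by simp
            \<comment> \<open>For \<open>- \<Theta>\<close> the points \<open>p\<close> and
              \<open>q\<close> exchange roles. The section function is reflected, and the modulus of
              the Fourier transform is even.\<close>
            then have "C / \<rho> * (parallel_section \<Omega> \<Theta> (p \<bullet> \<Theta> - 1 / \<rho>))\<^sup>2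
                \<le> (LINT s:{\<alpha>' * \<rho>..\<beta>' * \<rho>}|lborel. (cmod (fourier_transform (indicator \<Omega>) (s *\<^sub>R \<Theta>)))\<^sup>2)"
              "C / \<rho> * (parallel_section \<Omega> (- \<Theta>) (q \<bullet> (- \<Theta>) - 1 / \<rho>))\<^sup>2
                \<le> (LINT s:{\<alpha>' * \<rho>..\<beta>' * \<rho>}|lborel. (cmod (fourier_transform (indicator \<Omega>) (s *\<^sub>R (- \<Theta>))))\<^sup>2)"
              using edge[OF 2 p q \<rho>] edge[of "- \<Theta>" q p \<rho>] 2 p q \<rho> by simp_all
            then have "C / \<rho> * (parallel_section \<Omega> \<Theta> (p \<bullet> \<Theta> - 1 / \<rho>))\<^sup>2
                \<le> (LINT s:{\<alpha>' * \<rho>..\<beta>' * \<rho>}|lborel. (cmod (fourier_transform (indicator \<Omega>) (s *\<^sub>R \<Theta>)))\<^sup>2)"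
              "C / \<rho> * (parallel_section \<Omega> \<Theta> (- (- (q \<bullet> \<Theta>)) + 1 / \<rho>))\<^sup>2
                \<le> (LINT s:{\<alpha>' * \<rho>..\<beta>' * \<rho>}|lborel. (cmod (fourier_transform (indicator \<Omega>) (s *\<^sub>R \<Theta>)))\<^sup>2)"
              by (simp_all add: parallel_section_uminus cmod_fourier_transform_indicator_uminus add.commute)
            moreover have "C / 2 / \<rho> * (y + x) \<le> I" if "C / \<rho> * x \<le> I" "C / \<rho> * y \<le> I" for x y I
            proof -
              have "C / 2 / \<rho> * (y + x) = (C / \<rho> * x + C / \<rho> * y) / 2"
                by (simp add: algebra_simps add_divide_distrib)
              also have "\<dots> \<le> (I + I) / 2"
                using that by (intro divide_right_mono add_mono) auto
              finally show ?thesis by simp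
            qed
            ultimately show ?thesis by blast
          qed
          show ?case
          proof (intro exI conjI allI impI)
            show "- (q \<bullet> \<Theta>) > 0" "p \<bullet> \<Theta> > 0" using rp rq r by linarith+
          qed (fact supp bound)+
        qed (use C in simp)
      qed (use r in simp)
    qed (use pos in \<open>simp add: \<beta>'_def add_pos_nonneg\<close>)
  qed (use pos in \<open>simp add: \<alpha>'_def\<close>)
qed

end
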